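(* Let $\tilde{\mathcal{E}}$ be the subgroup of Thompson's group $F$ generated by the elements whose strip through the roots is $3$-colorable (see context). Then $\tilde{\mathcal{E}}$ coincides with the index $2$ subgroup of $F$ $$H=\{f\in F : \log_2 f'(0)\equiv_2\log_2 f'(1)\},$$ where $\equiv_2$ denotes equivalence modulo $2$.
   Context: Thompson's group $F$ is the group of piecewise linear homeomorphisms of $[0,1]$ differentiable except at finitely many dyadic rationals, with all slopes powers of $2$; the product is $(f\cdot g)(t)=g(f(t))$. Tree diagrams: a tree diagram is a pair $(T_+,T_-)$ of finite planar rooted binary trees with the same number $n$ of leaves. Vertices are finite binary words (root = empty word, $v0$ and $v1$ = left and right child of $v$). It represents the element of $F$ sending $.\alpha_k\gamma$ to $.\beta_k\gamma$ for each $k$ and each infinite binary word $\gamma$, where $\alpha_k,\beta_k$ are the $k$-th leaves (from left to right) of $T_+,T_-$. Every element of $F$ is so represented, uniquely up to inserting/deleting pairs of opposing carets. One draws $T_-$ upside down below $T_+$ and identifies the $k$-th leaves of the two trees. Strip through the roots: consider the horizontal strip whose two boundary lines pass through the roots of $T_+$ and $T_-$ respectively. The diagram partitions this strip into a leftmost region $R_0$, a (distinct) rightmost region $R_n$, and the regions $R_i$, $1\le i\le n-1$, between the $i$-th and $(i+1)$-th leaves. For a non-root vertex $v$ of $T_+$ or $T_-$ with descendant leaves numbered $p+1,\dots,q$, the edge from $v$ to its parent separates $R_p$ from $R_q$. The strip is $3$-colorable if there are colors $c(R_0),\dots,c(R_n)\in\mathbb{Z}_3$ such that regions sharing an edge have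 different colors, i.e. $c(R_p)\ne c(R_q)$ for every such non-root vertex $v$; in particular there is no condition between $c(R_0)$ and $c(R_n)$ coming from the roots. $\tilde{\mathcal{E}}$ is the subgroup generated by the elements of $F$ for which this strip is $3$-colorable. *)

theory Defs
  imports
    "HOL-Analysis.Analysis"
    "HOL-Algebra.Coset"
    "HOL-Algebra.Generated_Groups"
    "HOL-Library.Sublist"
    "HOL-Library.Stream"
    "HOL-Library.Numeral_Type"
    "HOL-Library.Real_Mod"
begin

section \<open>Thompson's group F\<close>

text \<open>Maps of the unit interval are represented as functions on the reals that are undefined
  outside \<open>{0..1}\<close>, so that equality in the carrier is equality as maps of \<open>{0..1}\<close>.
  The finite set \<open>D\<close> contains the breakpoints: on every subinterval of \<open>{0..1}\<close> with no point of
  \<open>D\<close> in its interior, \<open>f\<close> is affine and its slope is a power of 2.\<close>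

definition pl_dyadic :: "(real \<Rightarrow> real) \<Rightarrow> bool" where
  "pl_dyadic f \<longleftrightarrow>
     (\<exists>D. finite D \<and> D \<subseteq> dyadics \<and>
        (\<forall>a b. 0 \<le> a \<and> a < b \<and> b \<le> 1 \<and> {a<..<b} \<inter> D = {} \<longrightarrow>
           (\<exists>(k::int) c. \<forall>t\<in>{a..b}. f t = 2 powi k * t + c)))"

text \<open>Products are read from left to right: \<open>f \<cdot> g\<close> applies \<open>f\<close> first.\<close>

definition thompson_F :: "(real \<Rightarrow> real) monoid" where
  "thompson_F =
     \<lparr>carrier = {f \<in> extensional {0..1}. (\<exists>g. homeomorphism {0..1} {0..1} f g) \<and> pl_dyadic f},
      mult = (\<lambda>f g. compose {0..1} g f),
      one = restrict id {0..1}\<rparr>"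

section \<open>Tree diagrams\<close>

datatype bintree = Leaf | Caret bintree bintree

text \<open>Vertices are binary words, with \<open>False\<close> for 0 (left) and \<open>True\<close> for 1 (right);
  leaves are listed from left to right.\<close>

primrec vertices :: "bintree \<Rightarrow> bool list set" where
  "vertices Leaf = {[]}"
| "vertices (Caret l r) = insert [] (Cons False ` vertices l \<union> Cons True ` vertices r)"

primrec leaves :: "bintree \<Rightarrow> bool list list" where
  "leaves Leaf = [[]]"
| "leaves (Caret l r) = map (Cons False) (leaves l) @ map (Cons True) (leaves r)"

definition num_leaves :: "bintree \<Rightarrow> nat" where
  "num_leaves T = length (leaves T)"

definition tree_diagram :: "bintree \<times> bintree \<Rightarrow> bool" where
  "tree_diagram = (\<lambda>(Tp, Tm). num_leaves Tp = num_leaves Tm)"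

definition bin_val :: "bool stream \<Rightarrow> real" where
  "bin_val w = (\<Sum>i. of_bool (w !! i) / 2 ^ Suc i)"

definition represents :: "bintree \<times> bintree \<Rightarrow> (real \<Rightarrow> real) \<Rightarrow> bool" where
  "represents = (\<lambda>(Tp, Tm) f.
     \<forall>k < num_leaves Tp. \<forall>\<gamma>. f (bin_val (leaves Tp ! k @- \<gamma>)) = bin_val (leaves Tm ! k @- \<gamma>))"

section \<open>Colorings of the strip through the roots\<close>

text \<open>Numbers, counted from 1, of the leaves descending from the vertex \<open>v\<close>.\<close>

definition descendant_leaves :: "bintree \<Rightarrow> bool list \<Rightarrow> nat set" where
  "descendant_leaves T v = {k \<in> {1..num_leaves T}. prefix v (leaves T ! (k - 1))}"

text \<open>\<open>c i\<close> is the color of the region \<open>R\<^sub>i\<close>, for \<open>0 \<le> i \<le> num_leaves T\<close>, and the type \<open>3\<close> is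
  the ring of integers modulo 3. The descendant leaves of a vertex always form
  a nonempty interval \<open>{p + 1..q}\<close>. The root is excluded, so no condition relates the two
  outer regions.\<close>

definition proper_coloring :: "bintree \<Rightarrow> (nat \<Rightarrow> 3) \<Rightarrow> bool" where
  "proper_coloring T c \<longleftrightarrow>
     (\<forall>v \<in> vertices T - {[]}. \<forall>p q. p < q \<and> descendant_leaves T v = {p + 1..q} \<longrightarrow> c p \<noteq> c q)"

definition strip_colorable :: "bintree \<times> bintree \<Rightarrow> bool" where
  "strip_colorable = (\<lambda>(Tp, Tm). \<exists>c. proper_coloring Tp c \<and> proper_coloring Tm c)"

text \<open>Whether the strip is colorable does not depend on the diagram chosen for an element:
  a pair of opposing carets inserted at a leaf adds one region, which is adjacent to two regions only.\<close>

definition strip_colorable_elements :: "(real \<Rightarrow> real) set" where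
  "strip_colorable_elements =
     {f \<in> carrier thompson_F. \<exists>d. tree_diagram d \<and> represents d f \<and> strip_colorable d}"

definition E_tilde :: "(real \<Rightarrow> real) set" where
  "E_tilde = generate thompson_F strip_colorable_elements"

section \<open>The subgroup H\<close>

text \<open>At the endpoints 0 and 1 this is the one-sided derivative.\<close>

definition unit_deriv :: "(real \<Rightarrow> real) \<Rightarrow> real \<Rightarrow> real" where
  "unit_deriv f x = vector_derivative f (at x within {0..1})"

definition H_subgroup :: "(real \<Rightarrow> real) set" where
  "H_subgroup =
     {f \<in> carrier thompson_F. [log 2 (unit_deriv f 0) = log 2 (unit_deriv f 1)] (rmod 2)}"

end

theory Submission
  imports Defs
begin

text \<open>
  A colored edge whose two regions differ by \<open>\<delta>\<close> in \<open>\<int>\<^sub>3\<close> forces the third color between its two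
  children, whose edges therefore both differ by \<open>- \<delta>\<close>. Hence the first and the last leaf record the
  parities of their depths, and comparing the two trees of a colorable strip gives one inclusion.

  For the converse, \<open>F\<close> is generated by its standard generators \<open>x\<^sub>0\<close> and \<open>x\<^sub>1\<close>, which act on
  tree diagrams by rotations at the root and at its right child.
  The elements \<open>x\<^sub>0\<close>, \<open>x\<^sub>1\<^sup>2\<close> and \<open>x\<^sub>1 x\<^sub>0 x\<^sub>1\<^sup>-\<^sup>1\<close> are products of elements with colorable strip: join the
  two trees of each by a chain of trees in which any two consecutive trees have a common coloring.
  Therefore \<open>E_tilde\<close> and its coset of \<open>x\<^sub>1\<close> exhaust \<open>F\<close>, while \<open>x\<^sub>1\<close> does not lie in \<open>H\<close>.
\<close>

section \<open>Binary words and dyadic intervals\<close>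

text \<open>The coloring and the slopes at 0 and 1 both see only the outermost leaves, which is how
  the parity enters. The missing condition at the roots is what makes room: already for
  \<open>thompson_x0\<close> the two outer regions must receive the same color.

  The tree pairs used for the square of \<open>thompson_x1\<close> and for the conjugate of
  \<open>thompson_x0\<close> have no common coloring themselves, hence the chains of trees. A chain
  yields a product of elements because every pair of trees of equal size determines exactly one
  element of F, so membership in a subgroup becomes connectedness of trees. The square and the
  conjugate are just what is needed for two cosets to be stable under right multiplication by the
  generators; normality of \<open>E_tilde\<close> is only a consequence.

  The analytic obstacle is the passage from piecewise linear maps to pairs of trees. Elements of F
  preserve dyadic points, so a fine enough uniform subdivision is carried to dyadic intervals, and
  dyadic intervals that tile the unit interval are the leaves of a tree.\<close>

primrec word_val :: "bool list \<Rightarrow> real" where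
  "word_val [] = 0"
| "word_val (b # w) = (of_bool b + word_val w) / 2"

lemma word_val_append: "word_val (u @ w) = word_val u + word_val w / 2 ^ length u"
  by (induction u) (auto simp: field_simps)

lemma word_val_bounds: "0 \<le> word_val w" "word_val w + 1 / 2 ^ length w \<le> 1"
proof (induction w)
  case (Cons b w)
  case 2
  have "word_val (b # w) + 1 / 2 ^ length (b # w) = (of_bool b + (word_val w + 1 / 2 ^ length w)) / 2"
    by (simp add: add_divide_distrib mult.commute)
  also have "\<dots> \<le> (1 + 1) / 2" using Cons(2) by (intro divide_right_mono add_mono) auto
  finally show ?case by simp
qed auto

text \<open>The dyadic interval of \<open>w\<close> starts at \<open>word_val w\<close> and has
  length \<open>1 / 2 ^ length w\<close>; \<open>s\<close> is the relative position inside
  it.\<close>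

lemma word_point_in_unit:
  assumes "s \<in> {0..1}"
  shows "word_val w + s / 2 ^ length w \<in> {0..1}"
proof -
  have "0 \<le> s / 2 ^ length w" "s / 2 ^ length w \<le> 1 / 2 ^ length w"
    using assms by (auto intro: divide_right_mono)
  then show ?thesis using word_val_bounds[of w] by auto
qed

lemma word_val_replicate_False [simp]: "word_val (replicate n False) = 0"
  by (induction n) auto

lemma word_val_replicate_True [simp]: "word_val (replicate n True) = 1 - 1 / 2 ^ n"
  by (induction n) (auto simp: field_simps)

lemma ex_word_val:
  assumes "i < 2 ^ n"
  shows "\<exists>w. length w = n \<and> word_val w = real i / 2 ^ n"
  using assms
proof (induction n arbitrary: i)
  case (Suc n)
  show ?case
  proof (cases "i < 2 ^ n")
    case True
    then obtain w where "length w = n" "word_val w = real i / 2 ^ n" using Suc.IH by blast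
    then show ?thesis by (intro exI[of _ "False # w"]) auto
  next
    case False
    then have "i - 2 ^ n < 2 ^ n" using Suc.prems by auto
    then obtain w where "length w = n" "word_val w = real (i - 2 ^ n) / 2 ^ n"
      using Suc.IH by blast
    with False show ?thesis
      by (intro exI[of _ "True # w"]) (auto simp: of_nat_diff field_simps)
  qed
qed auto

section \<open>Values of infinite binary words\<close>

lemma summable_bin_val: "summable (\<lambda>i. of_bool (w !! i) / 2 ^ Suc i :: real)"
proof (rule summable_comparison_test')
  show "summable (\<lambda>i. (1 / 2) ^ Suc i :: real)"
    using summable_geometric[of "1 / 2 :: real"] by (simp add: summable_Suc_iff)
qed (auto simp: power_divide)

lemma bin_val_SCons: "bin_val (b ## w) = (of_bool b + bin_val w) / 2"
proof -
  have "bin_val (b ## w) = (\<Sum>i. of_bool ((b ## w) !! Suc i) / 2 ^ Suc (Suc i)) + of_bool b / 2"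
    unfolding bin_val_def using suminf_split_head[OF summable_bin_val[of "b ## w"]] by simp
  also have "(\<Sum>i. of_bool ((b ## w) !! Suc i) / 2 ^ Suc (Suc i) :: real)
      = (\<Sum>i. (of_bool (w !! i) / 2 ^ Suc i) / 2)"
    by (simp add: field_simps)
  also have "\<dots> = bin_val w / 2"
    unfolding bin_val_def by (rule suminf_divide[OF summable_bin_val])
  finally show ?thesis by simp
qed

lemma bin_val_shift: "bin_val (u @- w) = word_val u + bin_val w / 2 ^ length u"
  by (induction u) (auto simp: bin_val_SCons field_simps)

lemma bin_val_in_unit: "bin_val w \<in> {0..1}"
proof -
  have "bin_val w \<le> (\<Sum>i. (1 / 2) ^ Suc i)"
    unfolding bin_val_def
    by (rule suminf_le[OF _ summable_bin_val sums_summable[OF power_half_series]])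
      (auto simp: power_divide)
  also have "\<dots> = (1::real)" using power_half_series sums_unique by force
  finally show ?thesis
    unfolding bin_val_def using suminf_nonneg[OF summable_bin_val] by auto
qed

text \<open>Bridges \<open>represents\<close>, which quantifies over infinite words, and statements
  about all points of an interval.\<close>

lemma bin_val_surj:
  assumes "s \<in> {0..1}"
  obtains w where "bin_val w = s"
proof -
  have "\<exists>w. \<forall>n. \<bar>s - word_val (stake n w)\<bar> \<le> 1 / 2 ^ n"
  proof (cases "s = 1")
    case True
    have "stake n (sconst True) = replicate n True" for n
      by (induction n) (simp_all del: stake_siterate)
    with True show ?thesis by (intro exI[of _ "sconst True"]) simp
  next
    case False
    \<comment> \<open>Binary digits read off from floors. At \<open>s = 1\<close> all of them would
      be 0, so that point was given the constant word of ones instead.\<close>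
    define w where "w = smap (\<lambda>i. odd \<lfloor>s * 2 ^ Suc i\<rfloor>) nats"
    have nth: "w !! i \<longleftrightarrow> odd \<lfloor>s * 2 ^ Suc i\<rfloor>" for i by (simp add: w_def)
    have "word_val (stake n w) = \<lfloor>s * 2 ^ n\<rfloor> / 2 ^ n" for n
    proof (induction n)
      case 0
      with assms False show ?case by (simp add: floor_eq_iff)
    next
      case (Suc n)
      have "\<lfloor>s * 2 ^ Suc n\<rfloor> div 2 = \<lfloor>s * 2 ^ n\<rfloor>"
        using floor_divide_real_eq_div[of 2 "s * 2 ^ Suc n"] by (simp add: mult.commute)
      then have "\<lfloor>s * 2 ^ Suc n\<rfloor> = 2 * \<lfloor>s * 2 ^ n\<rfloor> + of_bool (w !! n)"
        unfolding nth by (metis mult_div_mod_eq mod_2_eq_odd of_bool_odd_eq_mod_2)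
      then have "real_of_int \<lfloor>s * 2 ^ Suc n\<rfloor> = 2 * \<lfloor>s * 2 ^ n\<rfloor> + of_bool (w !! n)"
        by simp
      with Suc show ?case
        by (simp only: stake_Suc word_val_append) (simp add: field_simps)
    qed
    moreover have "\<bar>s - \<lfloor>s * 2 ^ n\<rfloor> / 2 ^ n\<bar> \<le> 1 / 2 ^ n" for n
    proof -
      have "s - \<lfloor>s * 2 ^ n\<rfloor> / 2 ^ n = (s * 2 ^ n - \<lfloor>s * 2 ^ n\<rfloor>) / 2 ^ n" by (simp add: field_simps)
      moreover have "\<bar>s * 2 ^ n - \<lfloor>s * 2 ^ n\<rfloor>\<bar> \<le> 1" by linarith
      ultimately show ?thesis by (simp add: divide_right_mono)
    qed
    ultimately show ?thesis by (intro exI[of _ w]) simp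
  qed
  then obtain w where w: "\<bar>s - word_val (stake n w)\<bar> \<le> 1 / 2 ^ n" for n by blast
  have "\<bar>s - bin_val w\<bar> \<le> 2 * (1 / 2) ^ n" for n
  proof -
    have "bin_val w = word_val (stake n w) + bin_val (sdrop n w) / 2 ^ n"
      using bin_val_shift[of "stake n w" "sdrop n w"] by (simp add: stake_sdrop)
    moreover have "\<bar>bin_val (sdrop n w) / 2 ^ n\<bar> \<le> 1 / 2 ^ n"
      using bin_val_in_unit[of "sdrop n w"] by (simp add: divide_right_mono)
    ultimately have "\<bar>s - bin_val w\<bar> \<le> 2 * (1 / 2 ^ n)" using w[of n] by linarith
    then show ?thesis by (simp add: power_divide)
  qed
  moreover have "(\<lambda>n. 2 * (1 / 2) ^ n) \<longlonglongrightarrow> (2 * 0::real)"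
    by (intro tendsto_intros LIMSEQ_power_zero) auto
  ultimately have "\<bar>s - bin_val w\<bar> \<le> 2 * 0" using LIMSEQ_le_const by blast
  then show ?thesis using that by simp
qed

section \<open>Affine maps between dyadic intervals\<close>

text \<open>\<open>f\<close> carries the dyadic interval of \<open>u\<close> affinely onto that of
  \<open>v\<close>. With a real parameter in place of an infinite tail, the two expansions of a
  dyadic point need no attention.\<close>

definition maps_word :: "(real \<Rightarrow> real) \<Rightarrow> bool list \<Rightarrow> bool list \<Rightarrow> bool" where
  "maps_word f u v \<longleftrightarrow>
     (\<forall>s\<in>{0..1}. f (word_val u + s / 2 ^ length u) = word_val v + s / 2 ^ length v)"

lemma maps_word_iff_bin_val:
  "maps_word f u v \<longleftrightarrow> (\<forall>\<gamma>. f (bin_val (u @- \<gamma>)) = bin_val (v @- \<gamma>))"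
  unfolding maps_word_def bin_val_shift by (metis bin_val_surj bin_val_in_unit)

text \<open>Allows arbitrary subtrees to be hung below matched leaves: a few checks on short words
  then describe a rotation of all trees of a given shape.\<close>

lemma maps_word_append:
  assumes "maps_word f u v"
  shows "maps_word f (u @ w) (v @ w)"
  unfolding maps_word_def
proof
  fix s :: real assume "s \<in> {0..1}"
  then have "f (word_val u + (word_val w + s / 2 ^ length w) / 2 ^ length u)
      = word_val v + (word_val w + s / 2 ^ length w) / 2 ^ length v"
    using assms word_point_in_unit unfolding maps_word_def by blast
  then show "f (word_val (u @ w) + s / 2 ^ length (u @ w)) = word_val (v @ w) + s / 2 ^ length (v @ w)"
    by (simp add: word_val_append power_add add_divide_distrib mult.commute add.assoc)
qed

lemma maps_word_compose:
  assumes "maps_word f u v" "maps_word g v w"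
  shows "maps_word (compose {0..1} g f) u w"
  using assms word_point_in_unit unfolding maps_word_def compose_def by auto

lemma maps_word_inverse:
  assumes "maps_word f u v" "\<And>x. x \<in> {0..1} \<Longrightarrow> g (f x) = x"
  shows "maps_word g v u"
  using assms word_point_in_unit unfolding maps_word_def by metis

lemma maps_word_id: "maps_word (restrict id {0..1}) u u"
  using word_point_in_unit unfolding maps_word_def by auto

lemma represents_iff:
  assumes "num_leaves S = num_leaves T"
  shows "represents (S, T) f \<longleftrightarrow> list_all2 (maps_word f) (leaves S) (leaves T)"
  using assms unfolding represents_def maps_word_iff_bin_val num_leaves_def
  by (auto simp: list_all2_conv_all_nth)

lemma leaves_cover:
  assumes "x \<in> {0..1}"
  shows "\<exists>w\<in>set (leaves T). \<exists>s\<in>{0..1}. x = word_val w + s / 2 ^ length w"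
  using assms
proof (induction T arbitrary: x)
  case (Caret l r)
  show ?case
  proof (cases "x \<le> 1 / 2")
    case True
    then have "2 * x \<in> {0..1}" using Caret.prems by auto
    from Caret.IH(1)[OF this] obtain w s where
      "w \<in> set (leaves l)" "s \<in> {0..1}" "2 * x = word_val w + s / 2 ^ length w" by blast
    then show ?thesis by (intro bexI[of _ "False # w"] bexI[of _ s]) (auto simp: field_simps)
  next
    case False
    then have "2 * x - 1 \<in> {0..1}" using Caret.prems by auto
    from Caret.IH(2)[OF this] obtain w s where
      "w \<in> set (leaves r)" "s \<in> {0..1}" "2 * x - 1 = word_val w + s / 2 ^ length w" by blast
    then show ?thesis by (intro bexI[of _ "True # w"] bexI[of _ s]) (auto simp: field_simps)
  qed
qed auto

text \<open>The leaf intervals cover the unit interval, and outside it extensional functions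
  agree.\<close>

lemma maps_words_unique:
  assumes "f \<in> extensional {0..1}" "g \<in> extensional {0..1}"
    and "list_all2 (maps_word f) (leaves S) ws" "list_all2 (maps_word g) (leaves S) ws"
  shows "f = g"
proof (rule extensionalityI[OF assms(1,2)])
  fix x :: real assume "x \<in> {0..1}"
  then obtain w s where w: "w \<in> set (leaves S)" "s \<in> {0..1}" "x = word_val w + s / 2 ^ length w"
    using leaves_cover by blast
  then obtain i where "i < length (leaves S)" "w = leaves S ! i" by (metis in_set_conv_nth)
  then have "maps_word f w (ws ! i)" "maps_word g w (ws ! i)"
    using assms(3,4) by (auto simp: list_all2_conv_all_nth)
  with w show "f x = g x" by (simp add: maps_word_def)
qed

section \<open>Tilings by dyadic intervals and leaf lists\<close>

text \<open>The intervals of the words follow one another from \<open>x\<close> to \<open>y\<close>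
  without gap or overlap. The tilings of the unit interval turn out to be precisely the leaf lists
  of trees.\<close>

fun tiles :: "real \<Rightarrow> bool list list \<Rightarrow> real \<Rightarrow> bool" where
  "tiles x [] y \<longleftrightarrow> x = y"
| "tiles x (w # ws) y \<longleftrightarrow> word_val w = x \<and> tiles (x + 1 / 2 ^ length w) ws y"

lemma tiles_append: "tiles x (us @ vs) y \<longleftrightarrow> (\<exists>z. tiles x us z \<and> tiles z vs y)"
  by (induction us arbitrary: x) auto

lemma tiles_less: "tiles x ws y \<Longrightarrow> ws \<noteq> [] \<Longrightarrow> x < y"
proof (induction ws arbitrary: x)
  case (Cons w ws)
  then show ?case
    by (cases "ws = []") (auto intro: order.strict_trans[of _ "x + 1 / 2 ^ length w"])
qed simp

lemma tiles_map_False: "tiles x ws y \<Longrightarrow> tiles (x / 2) (map (Cons False) ws) (y / 2)"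
proof (induction ws arbitrary: x)
  case (Cons w ws)
  then show ?case
    using Cons.IH[of "x + 1 / 2 ^ length w"] by (simp add: add_divide_distrib mult.commute)
qed simp

lemma tiles_map_True: "tiles x ws y \<Longrightarrow> tiles ((1 + x) / 2) (map (Cons True) ws) ((1 + y) / 2)"
proof (induction ws arbitrary: x)
  case (Cons w ws)
  then show ?case
    using Cons.IH[of "x + 1 / 2 ^ length w"] by (simp add: add_divide_distrib mult.commute add.assoc)
qed simp

lemma tiles_leaves: "tiles 0 (leaves T) 1"
proof (induction T)
  case (Caret l r)
  show ?case
    using tiles_map_False[OF Caret.IH(1)] tiles_map_True[OF Caret.IH(2)]
    by (auto simp: tiles_append intro!: exI[of _ "1 / 2"])
qed auto

text \<open>The common endpoint of two neighbouring intervals has a single image, which ends one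
  image interval and begins the next.\<close>

lemma tiles_maps_word:
  "tiles x us y \<Longrightarrow> list_all2 (maps_word f) us vs \<Longrightarrow> tiles (f x) vs (f y)"
proof (induction us arbitrary: x vs)
  case (Cons u us)
  then obtain v vs' where vs: "vs = v # vs'" "maps_word f u v" "list_all2 (maps_word f) us vs'"
    by (auto simp: list_all2_Cons1)
  have "f (word_val u + 0 / 2 ^ length u) = word_val v + 0 / 2 ^ length v"
    "f (word_val u + 1 / 2 ^ length u) = word_val v + 1 / 2 ^ length v"
    using vs(2) unfolding maps_word_def by (meson atLeastAtMost_iff order_refl zero_le_one)+
  with Cons.IH[OF _ vs(3), of "word_val u + 1 / 2 ^ length u"] Cons.prems vs show ?case by auto
qed auto

text \<open>The interval of a word beginning with 0 has positive length and lies in the left half,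
  so it cannot start at 1/2 or later.\<close>

lemma tiles_right_half:
  "tiles x ws y \<Longrightarrow> [] \<notin> set ws \<Longrightarrow> 1 / 2 \<le> x \<Longrightarrow>
     \<exists>bs. ws = map (Cons True) bs \<and> tiles (2 * x - 1) bs (2 * y - 1)"
proof (induction ws arbitrary: x)
  case (Cons w ws)
  have w: "word_val w = x" "tiles (x + 1 / 2 ^ length w) ws y" using Cons.prems by auto
  obtain b w' where b: "w = b # w'" using Cons.prems by (cases w) auto
  have "b"
  proof (rule ccontr)
    assume "\<not> b"
    then have "word_val w' = 2 * x" using w b by simp
    moreover have "0 < 1 / (2::real) ^ length w'" by simp
    ultimately show False using word_val_bounds(2)[of w'] Cons.prems(3) by linarith
  qed
  moreover have "1 / 2 \<le> x + 1 / 2 ^ length w"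
    using Cons.prems(3) by (intro add_increasing2) auto
  then obtain bs where "ws = map (Cons True) bs" "tiles (2 * (x + 1 / 2 ^ length w) - 1) bs (2 * y - 1)"
    using Cons.IH[OF w(2)] Cons.prems by auto
  moreover have "2 * (x + 1 / 2 ^ length w) - 1 = 2 * x - 1 + 1 / 2 ^ length w'"
    using b by simp
  ultimately show ?case using w b
    by (intro exI[of _ "w' # bs"]) (auto simp: algebra_simps)
qed auto

text \<open>The interval of a nonempty word never straddles 1/2, so the tiling breaks there.
  Rescaling each half removes the first letters.\<close>

lemma tiles_halves:
  "tiles x ws y \<Longrightarrow> [] \<notin> set ws \<Longrightarrow> x \<le> 1 / 2 \<Longrightarrow> 1 / 2 \<le> y \<Longrightarrow>
     \<exists>as bs. ws = map (Cons False) as @ map (Cons True) bs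
       \<and> tiles (2 * x) as 1 \<and> tiles 0 bs (2 * y - 1)"
proof (induction ws arbitrary: x)
  case (Cons w ws)
  have w: "word_val w = x" "tiles (x + 1 / 2 ^ length w) ws y" using Cons.prems by auto
  obtain b w' where b: "w = b # w'" using Cons.prems by (cases w) auto
  show ?case
  proof (cases b)
    case True
    then have x: "x = 1 / 2" using w b word_val_bounds(1)[of w'] Cons.prems(3) by auto
    obtain bs where "w # ws = map (Cons True) bs" "tiles (2 * x - 1) bs (2 * y - 1)"
      using tiles_right_half[OF Cons.prems(1,2)] x by (metis order_refl)
    with x have "w # ws = map (Cons False) [] @ map (Cons True) bs
        \<and> tiles (2 * x) [] 1 \<and> tiles 0 bs (2 * y - 1)"
      by (metis append_Nil diff_self list.map(1) mult.commute nonzero_eq_divide_eq tiles.simps(1)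
          zero_neq_numeral)
    then show ?thesis by blast
  next
    case False
    then have "x + 1 / 2 ^ length w \<le> 1 / 2"
      using w b word_val_bounds(2)[of w'] by (auto simp: field_simps)
    then obtain as bs where "ws = map (Cons False) as @ map (Cons True) bs"
      "tiles (2 * (x + 1 / 2 ^ length w)) as 1" "tiles 0 bs (2 * y - 1)"
      using Cons.IH[OF w(2)] Cons.prems by auto
    moreover have "2 * (x + 1 / 2 ^ length w) = 2 * x + 1 / 2 ^ length w'"
      using b by simp
    ultimately show ?thesis using w b False
      by (intro exI[of _ "w' # as"] exI[of _ bs]) auto
  qed
qed auto

text \<open>If the empty word occurs, its interval is everything and the tree is a leaf. Otherwise
  both halves of the tiling are nonempty, hence shorter, and their trees are joined by a
  caret.\<close>

lemma tiles_imp_leaves: "tiles 0 ws 1 \<Longrightarrow> \<exists>T. leaves T = ws"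
proof (induction "length ws" arbitrary: ws rule: less_induct)
  case less
  show ?case
  proof (cases "[] \<in> set ws")
    case True
    then obtain us vs where ws: "ws = us @ [] # vs" by (meson split_list)
    with less.prems have "tiles 0 us 0" "tiles 1 vs 1" by (auto simp: tiles_append)
    then have "us = []" "vs = []" using tiles_less by blast+
    with ws show ?thesis by (intro exI[of _ Leaf]) auto
  next
    case False
    then obtain as bs where *: "ws = map (Cons False) as @ map (Cons True) bs"
      "tiles 0 as 1" "tiles 0 bs 1"
      using tiles_halves[OF less.prems] by auto
    then have "as \<noteq> []" "bs \<noteq> []" by auto
    with * have "length as < length ws" "length bs < length ws" by auto
    with * less.hyps obtain l r where "leaves l = as" "leaves r = bs" by blast
    with * show ?thesis by (intro exI[of _ "Caret l r"]) auto
  qed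
qed

section \<open>The group structure and the slopes at the endpoints\<close>

text \<open>The constant \<^const>\<open>dyadics\<close> contains only nonnegative numbers, so it is not closed under
  subtraction.\<close>

definition is_dyadic :: "real \<Rightarrow> bool" where
  "is_dyadic x \<longleftrightarrow> (\<exists>k::nat. x * 2 ^ k \<in> \<int>)"

lemma dyadics_iff_is_dyadic: "x \<in> dyadics \<longleftrightarrow> 0 \<le> x \<and> is_dyadic x"
proof
  assume "x \<in> dyadics"
  then obtain k m where "x = of_nat m / 2 ^ k" by (auto simp: dyadics_def)
  then have "x * 2 ^ k = of_nat m" "0 \<le> x" by simp_all
  then show "0 \<le> x \<and> is_dyadic x" unfolding is_dyadic_def by (metis Ints_of_nat)
next
  assume x: "0 \<le> x \<and> is_dyadic x"
  then obtain k where k: "x * 2 ^ k \<in> \<int>" by (auto simp: is_dyadic_def)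
  then obtain m where m: "x * 2 ^ k = of_int m" by (auto elim: Ints_cases)
  with x have "0 \<le> m" by (metis of_int_0_le_iff mult_nonneg_nonneg zero_le_power zero_le_numeral)
  then have "x = of_nat (nat m) / 2 ^ k" using m by (simp add: field_simps)
  then show "x \<in> dyadics" unfolding dyadics_def by blast
qed

lemma is_dyadic_mono: "x * 2 ^ k \<in> \<int> \<Longrightarrow> k \<le> n \<Longrightarrow> x * 2 ^ n \<in> (\<int> :: real set)"
  using Ints_mult[of "x * 2 ^ k" "2 ^ (n - k)"] by (simp add: mult.assoc flip: power_add)

lemma is_dyadic_common:
  assumes "finite X" "\<And>x. x \<in> X \<Longrightarrow> is_dyadic x"
  obtains n where "\<And>x. x \<in> X \<Longrightarrow> x * 2 ^ n \<in> \<int>"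
proof -
  obtain k where "\<And>x. x \<in> X \<Longrightarrow> x * 2 ^ k x \<in> \<int>"
    using assms(2) unfolding is_dyadic_def by metis
  then have "x * 2 ^ (Max (k ` X)) \<in> \<int>" if "x \<in> X" for x
    using that assms(1) by (meson Max_ge finite_imageI image_eqI is_dyadic_mono)
  then show ?thesis using that by blast
qed

lemma is_dyadic_add:
  assumes "is_dyadic x" "is_dyadic y"
  shows "is_dyadic (x + y)"
proof -
  obtain n where "\<And>z. z \<in> {x, y} \<Longrightarrow> z * 2 ^ n \<in> \<int>"
    using assms is_dyadic_common[of "{x, y}"] by blast
  then have "(x + y) * 2 ^ n \<in> \<int>" by (simp add: distrib_right)
  then show ?thesis unfolding is_dyadic_def by blast
qed

lemma is_dyadic_minus: "is_dyadic x \<Longrightarrow> is_dyadic (- x)"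
  by (auto simp: is_dyadic_def)

lemma is_dyadic_diff: "is_dyadic x \<Longrightarrow> is_dyadic y \<Longrightarrow> is_dyadic (x - y)"
  using is_dyadic_add[of x "- y"] is_dyadic_minus by simp

lemma is_dyadic_0 [simp]: "is_dyadic 0"
  by (simp add: is_dyadic_def)

lemma is_dyadic_powi_mult:
  assumes "is_dyadic x" shows "is_dyadic (2 powi k * x)"
proof -
  obtain j where j: "x * 2 ^ j \<in> \<int>" using assms by (auto simp: is_dyadic_def)
  show ?thesis
  proof (cases "0 \<le> k")
    case True
    have "2 ^ nat k * (x * 2 ^ j) \<in> \<int>" by (intro Ints_mult j) auto
    with True show ?thesis
      by (auto simp: is_dyadic_def power_int_def mult.assoc intro!: exI[of _ j])
  next
    case False
    then have "2 powi k * x * 2 ^ (j + nat (- k)) = x * 2 ^ j"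
      by (simp add: power_int_def power_add power_inverse divide_simps)
    with j show ?thesis unfolding is_dyadic_def by metis
  qed
qed

lemma is_dyadic_powi_mult_iff: "is_dyadic (2 powi k * x) \<longleftrightarrow> is_dyadic x"
  using is_dyadic_powi_mult[of "2 powi k * x" "- k"] is_dyadic_powi_mult[of x k]
  by (auto simp: power_int_minus simp flip: mult.assoc)

section \<open>Monotonicity, dyadic points and the group axioms\<close>

lemma ex_gap_right:
  fixes x y :: real
  assumes "finite D" "x < y"
  obtains e where "x < e" "e \<le> y" "{x<..<e} \<inter> D = {}"
proof
  let ?e = "Min (insert y {d \<in> D. x < d})"
  show "x < ?e" "?e \<le> y" using assms by auto
  show "{x<..<?e} \<inter> D = {}"
  proof (rule equals0I)
    fix d assume "d \<in> {x<..<?e} \<inter> D"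
    moreover then have "?e \<le> d" using assms by (intro Min_le) auto
    ultimately show False by auto
  qed
qed

text \<open>The clause \<open>e = x \<or> e \<in> D\<close> lets an induction descend from a point
  to the breakpoint before it.\<close>

lemma ex_gap_left:
  fixes x y :: real
  assumes "finite D" "x < y"
  obtains e where "x \<le> e" "e < y" "{e<..<y} \<inter> D = {}" "e = x \<or> e \<in> D"
proof
  let ?X = "insert x {d \<in> D. x < d \<and> d < y}"
  let ?e = "Max ?X"
  have "?e \<in> ?X" using assms by (intro Max_in) auto
  then show "?e < y" "?e = x \<or> ?e \<in> D" using assms by auto
  show "x \<le> ?e" using assms by auto
  show "{?e<..<y} \<inter> D = {}"
  proof (rule equals0I)
    fix d assume "d \<in> {?e<..<y} \<inter> D"
    moreover then have "d \<le> ?e" using assms by (intro Max_ge) (auto simp: not_less)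
    ultimately show False by auto
  qed
qed

lemma pl_dyadicE:
  assumes "pl_dyadic f"
  obtains D where "finite D" "D \<subseteq> dyadics"
    "\<And>a b. 0 \<le> a \<Longrightarrow> a < b \<Longrightarrow> b \<le> 1 \<Longrightarrow> {a<..<b} \<inter> D = {} \<Longrightarrow>
       \<exists>k::int. \<exists>c. \<forall>t\<in>{a..b}. f t = 2 powi k * t + c"
proof -
  obtain D where "finite D" "D \<subseteq> dyadics"
    "\<forall>a b. 0 \<le> a \<and> a < b \<and> b \<le> 1 \<and> {a<..<b} \<inter> D = {} \<longrightarrow>
       (\<exists>(k::int) c. \<forall>t\<in>{a..b}. f t = 2 powi k * t + c)"
    using assms unfolding pl_dyadic_def by auto
  then show ?thesis by (intro that[of D]) simp_all
qed

lemma carrier_thompson_F: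
  "f \<in> carrier thompson_F \<longleftrightarrow>
     f \<in> extensional {0..1} \<and> (\<exists>g. homeomorphism {0..1} {0..1} f g) \<and> pl_dyadic f"
  by (simp add: thompson_F_def)

lemma mult_thompson_F [simp]: "f \<otimes>\<^bsub>thompson_F\<^esub> g = compose {0..1} g f"
  and one_thompson_F [simp]: "\<one>\<^bsub>thompson_F\<^esub> = restrict id {0..1}"
  by (simp_all add: thompson_F_def)

lemma thompson_F_image: "f \<in> carrier thompson_F \<Longrightarrow> f ` {0..1} = {0..1}"
  by (auto simp: carrier_thompson_F homeomorphism_def)

lemma thompson_F_in_unit: "f \<in> carrier thompson_F \<Longrightarrow> t \<in> {0..1} \<Longrightarrow> f t \<in> {0..1}"
  using thompson_F_image by blast

text \<open>A homeomorphism of an interval is monotone in one direction; the piece next to 0 has a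
  positive slope, which rules out decreasing.\<close>

lemma thompson_F_strict_mono:
  assumes "f \<in> carrier thompson_F"
  shows "strict_mono_on {0..1} f"
proof -
  obtain g where "homeomorphism {0..1} {0..1} f g" using assms by (auto simp: carrier_thompson_F)
  then have "continuous_on {0..1} f" "inj_on f {0..1}"
    by (auto simp: homeomorphism_def intro: inj_on_inverseI)
  then have "strict_mono_on {0..1} f \<or> strict_antimono_on {0..1} f"
    using injective_eq_monotone_map[of "{0..1}" f] by (auto simp: is_interval_cc)
  moreover have "\<not> strict_antimono_on {0..1} f"
  proof
    assume anti: "strict_antimono_on {0..1} f"
    obtain D where D: "finite D" "\<And>a b. 0 \<le> a \<Longrightarrow> a < b \<Longrightarrow> b \<le> 1 \<Longrightarrow> {a<..<b} \<inter> D = {} \<Longrightarrow>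
       \<exists>k::int. \<exists>c. \<forall>t\<in>{a..b}. f t = 2 powi k * t + c"
      using assms by (auto simp: carrier_thompson_F elim: pl_dyadicE)
    obtain e where e: "0 < e" "e \<le> 1" "{0<..<e} \<inter> D = {}"
      using ex_gap_right[OF D(1), of 0 1] by (metis zero_less_one)
    then obtain k :: int and c where "\<forall>t\<in>{0..e}. f t = 2 powi k * t + c"
      using D(2)[of 0 e] by auto
    then have "f 0 < f e" using e by simp
    moreover have "f e < f 0"
      using anti e by (auto simp: monotone_on_def)
    ultimately show False by simp
  qed
  ultimately show ?thesis by blast
qed

lemma thompson_F_less_iff:
  assumes "f \<in> carrier thompson_F" "s \<in> {0..1}" "t \<in> {0..1}"
  shows "f s < f t \<longleftrightarrow> s < t"
  using strict_mono_on_less[OF thompson_F_strict_mono[OF assms(1)]] assms by blast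

lemma thompson_F_endpoints:
  assumes "f \<in> carrier thompson_F"
  shows "f 0 = 0" "f 1 = 1"
proof -
  obtain s t where st: "s \<in> {0..1}" "f s = 0" "t \<in> {0..1}" "f t = 1"
    using thompson_F_image[OF assms] by (smt (verit) atLeastAtMost_iff imageE)
  have "f 0 \<in> {0..1}" "f 1 \<in> {0..1}" using thompson_F_in_unit[OF assms] by auto
  then have "\<not> 0 < s" "\<not> t < 1"
    using thompson_F_less_iff[OF assms, of 0 s] thompson_F_less_iff[OF assms, of t 1] st by auto
  with st show "f 0 = 0" "f 1 = 1" by auto
qed

text \<open>With \<open>d\<close> the breakpoint before \<open>t\<close>, or 0, the value
  \<open>f t\<close> is \<open>f d\<close> plus a power of 2 times \<open>t - d\<close>; induction
  on the number of breakpoints below \<open>t\<close>. One direction makes the breakpoints of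
  products dyadic (preimages), the other those of inverses (images).\<close>

lemma thompson_F_is_dyadic_iff:
  assumes f: "f \<in> carrier thompson_F" and t: "t \<in> {0..1}"
  shows "is_dyadic (f t) \<longleftrightarrow> is_dyadic t"
proof -
  obtain D where D: "finite D" "D \<subseteq> dyadics"
    "\<And>a b. 0 \<le> a \<Longrightarrow> a < b \<Longrightarrow> b \<le> 1 \<Longrightarrow> {a<..<b} \<inter> D = {} \<Longrightarrow>
       \<exists>k::int. \<exists>c. \<forall>t\<in>{a..b}. f t = 2 powi k * t + c"
    using f by (auto simp: carrier_thompson_F elim: pl_dyadicE)
  show ?thesis using t
  proof (induction "card {d \<in> D. d < t}" arbitrary: t rule: less_induct)
    case less
    show ?case
    proof (cases "t = 0")
      case True
      then show ?thesis using thompson_F_endpoints[OF f] by simp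
    next
      case False
      then have "0 < t" using less.prems by auto
      then obtain d where d: "0 \<le> d" "d < t" "{d<..<t} \<inter> D = {}" "d = 0 \<or> d \<in> D"
        using ex_gap_left[OF D(1)] by blast
      then obtain k :: int and c where "\<forall>s\<in>{d..t}. f s = 2 powi k * s + c"
        using D(3)[of d t] less.prems by auto
      then have eq: "f t = f d + 2 powi k * (t - d)" using d by (auto simp: algebra_simps)
      have dd: "is_dyadic d" using d D(2) dyadics_iff_is_dyadic by auto
      have "is_dyadic (f d)"
      proof (cases "d = 0")
        case True
        then show ?thesis using thompson_F_endpoints[OF f] by simp
      next
        case False
        with d have "d \<in> D" by auto
        with d have "{d' \<in> D. d' < d} \<subset> {d' \<in> D. d' < t}" by auto
        then have "card {d' \<in> D. d' < d} < card {d' \<in> D. d' < t}"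
          using D(1) by (intro psubset_card_mono) auto
        then show ?thesis using less.hyps[of d] d dd less.prems by auto
      qed
      then have "is_dyadic (f t) \<longleftrightarrow> is_dyadic (2 powi k * (t - d))"
        using eq is_dyadic_add is_dyadic_diff by (metis add_diff_cancel_left')
      also have "\<dots> \<longleftrightarrow> is_dyadic t"
        unfolding is_dyadic_powi_mult_iff using dd is_dyadic_add is_dyadic_diff by (metis diff_add_cancel)
      finally show ?thesis .
    qed
  qed
qed

lemma thompson_FI:
  assumes "f \<in> extensional {0..1}" "continuous_on {0..1} f" "strict_mono_on {0..1} f"
    "f 0 = 0" "f 1 = 1" "pl_dyadic f"
  shows "f \<in> carrier thompson_F"
proof -
  have "f ` {0..1} = {0..1}"
  proof
    show "f ` {0..1} \<subseteq> {0..1}"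
      using assms(3-5) strict_mono_on_leD[OF assms(3), of 0] strict_mono_on_leD[OF assms(3), of _ 1] by auto
    show "{0..1} \<subseteq> f ` {0..1}"
    proof
      fix y :: real assume "y \<in> {0..1}"
      then show "y \<in> f ` {0..1}" using IVT'[of f 0 y 1] assms by auto
    qed
  qed
  then have "\<exists>g. homeomorphism {0..1} {0..1} f g"
    using assms(2,3) by (intro homeomorphism_compact) (auto intro: strict_mono_on_imp_inj_on)
  with assms show ?thesis by (simp add: carrier_thompson_F)
qed

lemma thompson_F_compose:
  assumes f: "f \<in> carrier thompson_F" and g: "g \<in> carrier thompson_F"
  shows "compose {0..1} g f \<in> carrier thompson_F"
proof -
  obtain D where D: "finite D" "D \<subseteq> dyadics"
    "\<And>a b. 0 \<le> a \<Longrightarrow> a < b \<Longrightarrow> b \<le> 1 \<Longrightarrow> {a<..<b} \<inter> D = {} \<Longrightarrow>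
       \<exists>k::int. \<exists>c. \<forall>t\<in>{a..b}. f t = 2 powi k * t + c"
    using f by (auto simp: carrier_thompson_F elim: pl_dyadicE)
  obtain D' where D': "finite D'" "D' \<subseteq> dyadics"
    "\<And>a b. 0 \<le> a \<Longrightarrow> a < b \<Longrightarrow> b \<le> 1 \<Longrightarrow> {a<..<b} \<inter> D' = {} \<Longrightarrow>
       \<exists>k::int. \<exists>c. \<forall>t\<in>{a..b}. g t = 2 powi k * t + c"
    using g by (auto simp: carrier_thompson_F elim: pl_dyadicE)
  obtain f' where f': "homeomorphism {0..1} {0..1} f f'" using f by (auto simp: carrier_thompson_F)
  obtain g' where g': "homeomorphism {0..1} {0..1} g g'" using g by (auto simp: carrier_thompson_F)
  have "homeomorphism {0..1} {0..1} (g \<circ> f) (f' \<circ> g')" by (rule homeomorphism_compose[OF f' g'])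
  then have "homeomorphism {0..1} {0..1} (compose {0..1} g f) (f' \<circ> g')"
    by (rule homeomorphism_cong) (auto simp: compose_def)
  moreover have "pl_dyadic (compose {0..1} g f)"
    unfolding pl_dyadic_def
  proof (intro exI[of _ "D \<union> {t \<in> {0..1}. f t \<in> D'}"] conjI allI impI)
    have "inj_on f {0..1}" using thompson_F_strict_mono[OF f] strict_mono_on_imp_inj_on by blast
    then have "finite (f -` D' \<inter> {0..1})" using D'(1) finite_vimage_IntI by blast
    moreover have "{t \<in> {0..1}. f t \<in> D'} = f -` D' \<inter> {0..1}" by auto
    ultimately show "finite (D \<union> {t \<in> {0..1}. f t \<in> D'})" using D(1) by simp
    show "D \<union> {t \<in> {0..1}. f t \<in> D'} \<subseteq> dyadics"
      using D(2) D'(2) thompson_F_is_dyadic_iff[OF f] by (auto simp: dyadics_iff_is_dyadic subset_iff)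
    fix a b :: real
    assume ab: "0 \<le> a \<and> a < b \<and> b \<le> 1 \<and> {a<..<b} \<inter> (D \<union> {t \<in> {0..1}. f t \<in> D'}) = {}"
    then obtain k :: int and c where kc: "\<forall>t\<in>{a..b}. f t = 2 powi k * t + c"
      using D(3)[of a b] by blast
    have "{f a<..<f b} \<inter> D' = {}"
    proof (rule equals0I)
      fix y assume y: "y \<in> {f a<..<f b} \<inter> D'"
      moreover have "f a \<in> {0..1}" "f b \<in> {0..1}" using ab thompson_F_in_unit[OF f] by auto
      ultimately have "y \<in> {0..1}" by auto
      then obtain t where t: "t \<in> {0..1}" "y = f t" using thompson_F_image[OF f] by blast
      have "f a < f t" "f t < f b" "a \<in> {0..1}" "b \<in> {0..1}" using y t(2) ab by simp_all
      then have "a < t" "t < b"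
        using thompson_F_less_iff[OF f _ t(1), of a] thompson_F_less_iff[OF f t(1), of b] by iprover+
      with t y have "t \<in> {a<..<b} \<inter> (D \<union> {t \<in> {0..1}. f t \<in> D'})" by simp
      with ab show False by (metis emptyE)
    qed
    moreover have "f a < f b" using thompson_F_less_iff[OF f, of a b] ab by auto
    moreover have "f a \<in> {0..1}" "f b \<in> {0..1}" using ab thompson_F_in_unit[OF f] by auto
    ultimately obtain l :: int and d where ld: "\<forall>y\<in>{f a..f b}. g y = 2 powi l * y + d"
      using D'(3)[of "f a" "f b"] by auto
    have "compose {0..1} g f t = 2 powi (l + k) * t + (2 powi l * c + d)" if t: "t \<in> {a..b}" for t
    proof -
      have "f t \<in> {f a..f b}"
        using thompson_F_less_iff[OF f, of t a] thompson_F_less_iff[OF f, of b t] t ab by auto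
      then have "g (f t) = 2 powi l * (2 powi k * t + c) + d" using ld kc t by simp
      then show ?thesis using t ab by (simp add: compose_def power_int_add algebra_simps)
    qed
    then show "\<exists>(k::int) c. \<forall>t\<in>{a..b}. compose {0..1} g f t = 2 powi k * t + c" by blast
  qed
  ultimately show ?thesis by (auto simp: carrier_thompson_F)
qed

lemma thompson_F_one: "restrict id {0..1} \<in> carrier thompson_F"
proof (rule thompson_FI)
  show "continuous_on {0..1} (restrict id {0..1::real})"
    by (rule continuous_on_eq[of _ id]) auto
  show "pl_dyadic (restrict id {0..1})"
    unfolding pl_dyadic_def
    by (intro exI[of _ "{}"] conjI allI impI) (auto intro!: exI[of _ "0::int"] exI[of _ "0::real"])
qed (auto simp: strict_mono_on_def)

lemma thompson_F_inverse:
  assumes f: "f \<in> carrier thompson_F" and h: "homeomorphism {0..1} {0..1} f g"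
  shows "restrict g {0..1} \<in> carrier thompson_F"
proof -
  obtain D where D: "finite D" "D \<subseteq> dyadics"
    "\<And>a b. 0 \<le> a \<Longrightarrow> a < b \<Longrightarrow> b \<le> 1 \<Longrightarrow> {a<..<b} \<inter> D = {} \<Longrightarrow>
       \<exists>k::int. \<exists>c. \<forall>t\<in>{a..b}. f t = 2 powi k * t + c"
    using f by (auto simp: carrier_thompson_F elim: pl_dyadicE)
  have g: "g y \<in> {0..1}" "f (g y) = y" if "y \<in> {0..1}" for y
    using h that by (auto simp: homeomorphism_def)
  have less: "g x < t \<longleftrightarrow> x < f t" "t < g x \<longleftrightarrow> f t < x" if "x \<in> {0..1}" "t \<in> {0..1}" for x t
    using thompson_F_less_iff[OF f g(1)[OF that(1)] that(2)]
      thompson_F_less_iff[OF f that(2) g(1)[OF that(1)]] unfolding g(2)[OF that(1)] by blast+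
  have "homeomorphism {0..1} {0..1} g f" using h by (rule homeomorphism_symD)
  then have "homeomorphism {0..1} {0..1} (restrict g {0..1}) f"
    by (rule homeomorphism_cong) auto
  moreover have "pl_dyadic (restrict g {0..1})"
    unfolding pl_dyadic_def
  proof (intro exI[of _ "f ` (D \<inter> {0..1})"] conjI allI impI)
    show "finite (f ` (D \<inter> {0..1}))" using D(1) by auto
    show "f ` (D \<inter> {0..1}) \<subseteq> dyadics"
      using D(2) thompson_F_is_dyadic_iff[OF f] thompson_F_in_unit[OF f]
      by (auto simp: dyadics_iff_is_dyadic subset_iff)
    fix a b :: real
    assume ab: "0 \<le> a \<and> a < b \<and> b \<le> 1 \<and> {a<..<b} \<inter> f ` (D \<inter> {0..1}) = {}"
    then have ga: "g a \<in> {0..1}" "g b \<in> {0..1}" using g by auto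
    moreover have "g a < g b" using less(1)[of a "g b"] g(2)[of b] ab ga by auto
    moreover have "{g a<..<g b} \<inter> D = {}"
    proof (rule equals0I)
      fix t assume t: "t \<in> {g a<..<g b} \<inter> D"
      with ga have "t \<in> {0..1}" by auto
      moreover from this have "a < f t" "f t < b" using less(1)[of a t] less(2)[of b t] t ab by auto
      ultimately have "f t \<in> {a<..<b} \<inter> f ` (D \<inter> {0..1})" using t by simp
      with ab show False by (metis emptyE)
    qed
    ultimately obtain k :: int and c where kc: "\<forall>t\<in>{g a..g b}. f t = 2 powi k * t + c"
      using D(3)[of "g a" "g b"] by auto
    have "restrict g {0..1} y = 2 powi (- k) * y + (- (2 powi (- k)) * c)" if y: "y \<in> {a..b}" for y
    proof -
      have y01: "y \<in> {0..1}" using y ab by auto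
      have "g y \<in> {g a..g b}"
        using less(1)[of y "g a"] less(2)[of y "g b"] y ab y01 g by (auto simp: not_less[symmetric])
      then have "y = 2 powi k * g y + c" using kc g(2)[OF y01] by metis
      then have "2 powi (- k) * y = 2 powi (- k) * (2 powi k * g y + c)" by simp
      then show ?thesis using y01 by (simp add: power_int_minus algebra_simps)
    qed
    then show "\<exists>(k::int) c. \<forall>t\<in>{a..b}. restrict g {0..1} t = 2 powi k * t + c" by blast
  qed
  ultimately show ?thesis by (auto simp: carrier_thompson_F)
qed

lemma group_thompson_F: "group thompson_F"
proof (rule groupI)
  fix f g h assume fgh: "f \<in> carrier thompson_F" "g \<in> carrier thompson_F" "h \<in> carrier thompson_F"
  show "f \<otimes>\<^bsub>thompson_F\<^esub> g \<in> carrier thompson_F"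
    using fgh by (simp add: thompson_F_compose)
  show "f \<otimes>\<^bsub>thompson_F\<^esub> g \<otimes>\<^bsub>thompson_F\<^esub> h = f \<otimes>\<^bsub>thompson_F\<^esub> (g \<otimes>\<^bsub>thompson_F\<^esub> h)"
    using fgh thompson_F_in_unit by (auto simp: compose_def fun_eq_iff)
next
  fix f assume f: "f \<in> carrier thompson_F"
  then show "\<one>\<^bsub>thompson_F\<^esub> \<otimes>\<^bsub>thompson_F\<^esub> f = f"
    by (auto simp: compose_def carrier_thompson_F extensional_def fun_eq_iff)
  obtain g where g: "homeomorphism {0..1} {0..1} f g" using f by (auto simp: carrier_thompson_F)
  then have "restrict g {0..1} \<otimes>\<^bsub>thompson_F\<^esub> f = \<one>\<^bsub>thompson_F\<^esub>"
    by (auto simp: compose_def homeomorphism_def fun_eq_iff)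
  then show "\<exists>g\<in>carrier thompson_F. g \<otimes>\<^bsub>thompson_F\<^esub> f = \<one>\<^bsub>thompson_F\<^esub>"
    using thompson_F_inverse[OF f g] by blast
qed (simp add: thompson_F_one)

lemma thompson_F_inv_apply:
  assumes f: "f \<in> carrier thompson_F" and x: "x \<in> {0..1}"
  shows "(inv\<^bsub>thompson_F\<^esub> f) (f x) = x"
proof -
  interpret group thompson_F by (rule group_thompson_F)
  have "compose {0..1} (inv\<^bsub>thompson_F\<^esub> f) f = restrict id {0..1}"
    using r_inv[OF f] by simp
  then have "compose {0..1} (inv\<^bsub>thompson_F\<^esub> f) f x = restrict id {0..1} x" by simp
  with x show ?thesis by (simp add: compose_def)
qed

section \<open>Slopes at the endpoints and the subgroup H\<close>

text \<open>\<open>f\<close> is affine near its fixed point \<open>x\<close> with slope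
  \<open>2 powi k\<close>. Stated on a neighbourhood rather than by a derivative, so that exponents
  add under composition by mere substitution.\<close>

definition germ :: "(real \<Rightarrow> real) \<Rightarrow> real \<Rightarrow> int \<Rightarrow> bool" where
  "germ f x k \<longleftrightarrow> (\<exists>e>0. \<forall>t\<in>{0..1}. \<bar>t - x\<bar> < e \<longrightarrow> f t = x + 2 powi k * (t - x))"

lemma germ_unit_deriv:
  assumes "germ f x k" "x \<in> {0..1}"
  shows "log 2 (unit_deriv f x) = k"
proof -
  obtain e where e: "e > 0" "\<And>t. t \<in> {0..1} \<Longrightarrow> \<bar>t - x\<bar> < e \<Longrightarrow> f t = x + 2 powi k * (t - x)"
    using assms unfolding germ_def by blast
  have "((\<lambda>t. x + 2 powi k * (t - x)) has_vector_derivative (2 powi k)) (at x within {0..1})"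
    by (auto intro!: derivative_eq_intros)
  then have "(f has_vector_derivative (2 powi k)) (at x within {0..1})"
    using e assms(2) by (rule_tac has_vector_derivative_transform_within[where d = e]) (auto simp: dist_real_def)
  then have "unit_deriv f x = 2 powi k"
    unfolding unit_deriv_def using assms(2) by (intro vector_derivative_within_closed_interval) auto
  then show ?thesis by (simp flip: powr_real_of_int')
qed

lemma thompson_F_germ:
  assumes f: "f \<in> carrier thompson_F" and x: "x \<in> {0, 1}"
  obtains k where "germ f x k"
proof -
  obtain D where D: "finite D"
    "\<And>a b. 0 \<le> a \<Longrightarrow> a < b \<Longrightarrow> b \<le> 1 \<Longrightarrow> {a<..<b} \<inter> D = {} \<Longrightarrow>
       \<exists>k::int. \<exists>c. \<forall>t\<in>{a..b}. f t = 2 powi k * t + c"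
    using f by (auto simp: carrier_thompson_F elim: pl_dyadicE)
  from x consider "x = 0" | "x = 1" by auto
  then show ?thesis
  proof cases
    case 1
    obtain e where e: "0 < e" "e \<le> 1" "{0<..<e} \<inter> D = {}"
      using ex_gap_right[OF D(1), of 0 1] by (metis zero_less_one)
    then obtain k :: int and c where kc: "\<forall>t\<in>{0..e}. f t = 2 powi k * t + c"
      using D(2)[of 0 e] by auto
    then have "c = 0" using thompson_F_endpoints[OF f] e by force
    with kc e 1 have "germ f x k" unfolding germ_def by (intro exI[of _ e]) auto
    then show ?thesis by (rule that)
  next
    case 2
    obtain e where e: "0 \<le> e" "e < 1" "{e<..<1} \<inter> D = {}"
      using ex_gap_left[OF D(1), of 0 1] by (metis zero_less_one)
    then obtain k :: int and c where kc: "\<forall>t\<in>{e..1}. f t = 2 powi k * t + c"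
      using D(2)[of e 1] by auto
    then have "c = 1 - 2 powi k" using thompson_F_endpoints[OF f] e by force
    with kc e 2 have "germ f x k"
      unfolding germ_def by (intro exI[of _ "1 - e"]) (auto simp: algebra_simps)
    then show ?thesis by (rule that)
  qed
qed

lemma germ_compose:
  assumes "germ f x k" "germ g x l" "f \<in> carrier thompson_F"
  shows "germ (compose {0..1} g f) x (k + l)"
proof -
  obtain d where d: "d > 0" "\<And>t. t \<in> {0..1} \<Longrightarrow> \<bar>t - x\<bar> < d \<Longrightarrow> f t = x + 2 powi k * (t - x)"
    using assms(1) unfolding germ_def by blast
  obtain e where e: "e > 0" "\<And>t. t \<in> {0..1} \<Longrightarrow> \<bar>t - x\<bar> < e \<Longrightarrow> g t = x + 2 powi l * (t - x)"
    using assms(2) unfolding germ_def by blast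
  show ?thesis
    unfolding germ_def
  proof (intro exI[of _ "min d (e / 2 powi k)"] conjI ballI impI)
    show "0 < min d (e / 2 powi k)" using d e by simp
    fix t :: real assume t: "t \<in> {0..1}" "\<bar>t - x\<bar> < min d (e / 2 powi k)"
    then have ft: "f t = x + 2 powi k * (t - x)" using d by simp
    have "\<bar>t - x\<bar> * 2 powi k < e" using t by (simp add: pos_less_divide_eq)
    then have "\<bar>f t - x\<bar> < e" using ft by (simp add: abs_mult mult.commute)
    then have "g (f t) = x + 2 powi l * (f t - x)" using e thompson_F_in_unit[OF assms(3) t(1)] by simp
    then show "compose {0..1} g f t = x + 2 powi (k + l) * (t - x)"
      using t ft by (simp add: compose_def power_int_add)
  qed
qed

lemma log_unit_deriv_compose:
  assumes "f \<in> carrier thompson_F" "g \<in> carrier thompson_F" "x \<in> {0, 1}"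
  shows "log 2 (unit_deriv (compose {0..1} g f) x) = log 2 (unit_deriv f x) + log 2 (unit_deriv g x)"
proof -
  obtain k where k: "germ f x k" using thompson_F_germ[OF assms(1,3)] .
  obtain l where l: "germ g x l" using thompson_F_germ[OF assms(2,3)] .
  have "x \<in> {0..1}" using assms(3) by auto
  then show ?thesis
    using germ_compose[OF k l assms(1)] k l by (simp add: germ_unit_deriv)
qed

text \<open>A homomorphism to the additive reals; membership in \<open>H_subgroup\<close> becomes
  its being an even integer.\<close>

definition end_slope_diff :: "(real \<Rightarrow> real) \<Rightarrow> real" where
  "end_slope_diff f = log 2 (unit_deriv f 0) - log 2 (unit_deriv f 1)"

lemma end_slope_diff_mult:
  assumes "f \<in> carrier thompson_F" "g \<in> carrier thompson_F"
  shows "end_slope_diff (f \<otimes>\<^bsub>thompson_F\<^esub> g) = end_slope_diff f + end_slope_diff g"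
  using log_unit_deriv_compose[OF assms] by (simp add: end_slope_diff_def)

lemma H_subgroup_iff:
  "f \<in> H_subgroup \<longleftrightarrow> f \<in> carrier thompson_F \<and> (\<exists>n::int. end_slope_diff f = 2 * n)"
proof -
  have "[log 2 (unit_deriv f 0) = log 2 (unit_deriv f 1)] (rmod 2) \<longleftrightarrow> (\<exists>n::int. end_slope_diff f = 2 * n)"
    unfolding rcong_altdef end_slope_diff_def
  proof (intro iffI; elim exE)
    fix n :: int
    assume "log 2 (unit_deriv f 1) = log 2 (unit_deriv f 0) + of_int n * 2"
    then show "\<exists>n::int. log 2 (unit_deriv f 0) - log 2 (unit_deriv f 1) = 2 * of_int n"
      by (intro exI[of _ "- n"]) simp
  next
    fix n :: int
    assume "log 2 (unit_deriv f 0) - log 2 (unit_deriv f 1) = 2 * of_int n"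
    then show "\<exists>n::int. log 2 (unit_deriv f 1) = log 2 (unit_deriv f 0) + of_int n * 2"
      by (intro exI[of _ "- n"]) simp
  qed
  then show ?thesis by (simp add: H_subgroup_def)
qed

lemma subgroup_H: "subgroup H_subgroup thompson_F"
proof -
  interpret group thompson_F by (rule group_thompson_F)
  have one: "end_slope_diff \<one>\<^bsub>thompson_F\<^esub> = 0"
    using end_slope_diff_mult[OF one_closed one_closed] by (metis l_one one_closed add_cancel_left_left)
  show ?thesis
  proof (rule subgroupI)
    show "H_subgroup \<subseteq> carrier thompson_F" by (auto simp: H_subgroup_iff)
    have "\<one>\<^bsub>thompson_F\<^esub> \<in> H_subgroup"
      using one one_closed by (auto simp: H_subgroup_iff simp del: one_thompson_F intro: exI[of _ 0])
    then show "H_subgroup \<noteq> {}" by blast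
  next
    fix f assume f: "f \<in> H_subgroup"
    then obtain n :: int where n: "f \<in> carrier thompson_F" "end_slope_diff f = 2 * n"
      by (auto simp: H_subgroup_iff)
    then have "end_slope_diff (inv\<^bsub>thompson_F\<^esub> f) = of_int (2 * (- n))"
      using end_slope_diff_mult[OF n(1) inv_closed[OF n(1)]] one r_inv[OF n(1)] by simp
    then show "inv\<^bsub>thompson_F\<^esub> f \<in> H_subgroup"
      unfolding H_subgroup_iff using n(1) by (metis inv_closed of_int_mult of_int_numeral)
  next
    fix f g assume "f \<in> H_subgroup" "g \<in> H_subgroup"
    then obtain m n :: int where *: "f \<in> carrier thompson_F" "g \<in> carrier thompson_F"
      "end_slope_diff f = 2 * m" "end_slope_diff g = 2 * n"
      by (auto simp: H_subgroup_iff)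
    then have "end_slope_diff (f \<otimes>\<^bsub>thompson_F\<^esub> g) = of_int (2 * (m + n))"
      by (simp add: end_slope_diff_mult del: mult_thompson_F)
    then show "f \<otimes>\<^bsub>thompson_F\<^esub> g \<in> H_subgroup"
      unfolding H_subgroup_iff using *(1,2) by (metis m_closed of_int_mult of_int_numeral)
  qed
qed

section \<open>Tree diagrams and generators\<close>

lemma word_val_times_power_Ints: "word_val w * 2 ^ length w \<in> \<int>"
proof (induction w)
  case (Cons b w)
  have "word_val (b # w) * 2 ^ length (b # w) = of_bool b * 2 ^ length w + word_val w * 2 ^ length w"
    by (simp add: algebra_simps)
  also have "\<dots> \<in> \<int>" using Cons by (intro Ints_add) auto
  finally show ?case .
qed simp

text \<open>Slope \<open>2 powi k\<close> turns length \<open>1 / 2 ^ length w\<close> into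
  \<open>1 / 2 ^ M\<close> with \<open>M = length w - k\<close>. The image is a dyadic interval once
  its left endpoint is a multiple of its length, which holds as soon as \<open>2 ^ M\<close> clears
  the denominator of \<open>c\<close>.\<close>

lemma affine_word_image:
  fixes k :: int
  assumes f: "f \<in> carrier thompson_F"
    and aff: "\<And>t. t \<in> {word_val u..word_val u + 1 / 2 ^ length u} \<Longrightarrow> f t = 2 powi k * t + c"
  obtains L where "\<And>z. L \<le> length z \<Longrightarrow> \<exists>v. maps_word f (u @ z) v"
proof -
  have u01: "word_val u \<in> {0..1}" using word_point_in_unit[of 0 u] by simp
  have "c = f (word_val u) - 2 powi k * word_val u" using aff[of "word_val u"] by simp
  moreover have "is_dyadic (word_val u)" using word_val_times_power_Ints is_dyadic_def by blast
  ultimately have "is_dyadic c"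
    using thompson_F_is_dyadic_iff[OF f u01] is_dyadic_diff is_dyadic_powi_mult by simp
  then obtain m where m: "c * 2 ^ m \<in> \<int>" by (auto simp: is_dyadic_def)
  \<comment> \<open>The summand \<open>nat k\<close> compensates for a slope above 1, and
    \<open>m\<close> then gives \<open>m \<le> M\<close>.\<close>
  have "\<exists>v. maps_word f (u @ z) v" if z: "m + nat k \<le> length z" for z
  proof -
    define w where "w = u @ z"
    define M where "M = nat (int (length w) - k)"
    have M: "m \<le> M" "int M = int (length w) - k" using z by (auto simp: M_def w_def)
    have pow: "2 powi k / 2 ^ length w = 1 / (2 ^ M :: real)"
    proof -
      have "(2::real) powi k * 2 powi (int M) = 2 powi (int (length w))"
        using M by (simp flip: power_int_add)
      then show ?thesis by (simp add: field_simps)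
    qed
    obtain i where i: "word_val w * 2 ^ length w = of_int i"
      using word_val_times_power_Ints by (auto elim: Ints_cases)
    obtain d where d: "c * 2 ^ M = of_int d"
      using is_dyadic_mono[OF m M(1)] by (auto elim: Ints_cases)
    have fw: "f (word_val w + s / 2 ^ length w) = of_int (i + d) / 2 ^ M + s / 2 ^ M"
      if s: "s \<in> {0..1}" for s
    proof -
      have w: "word_val w + s / 2 ^ length w
          = word_val u + (word_val z + s / 2 ^ length z) / 2 ^ length u"
        by (simp add: w_def word_val_append power_add add_divide_distrib mult.commute)
      have "(word_val z + s / 2 ^ length z) \<in> {0..1}" using word_point_in_unit[OF s] .
      then have "word_val w + s / 2 ^ length w \<in> {word_val u..word_val u + 1 / 2 ^ length u}"
        unfolding w by (auto intro!: divide_right_mono)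
      then have "f (word_val w + s / 2 ^ length w) = 2 powi k * (word_val w + s / 2 ^ length w) + c"
        by (rule aff)
      also have "\<dots> = (of_int i + s) * (2 powi k / 2 ^ length w) + c"
        by (simp add: i[symmetric] field_simps)
      also have "\<dots> = (of_int i + s) / 2 ^ M + of_int d / 2 ^ M"
        unfolding pow by (simp add: d[symmetric])
      finally show ?thesis by (simp add: add_divide_distrib)
    qed
    \<comment> \<open>The image stays in the unit interval; at \<open>s = 0\<close> and
      \<open>s = 1\<close> this bounds the numerator, so that a word of length \<open>M\<close> has
      this value.\<close>
    have "of_int (i + d) / 2 ^ M + s / 2 ^ M \<in> {0..1::real}" if "s \<in> {0..1}" for s
      using thompson_F_in_unit[OF f word_point_in_unit[OF that, of w]] unfolding fw[OF that] .
    from this[of 0] this[of 1] have "0 \<le> of_int (i + d) / (2::real) ^ M"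
      "(of_int (i + d) + 1) / 2 ^ M \<le> (1::real)"
      by (simp_all add: add_divide_distrib)
    then have "(0::real) \<le> of_int (i + d)" "of_int (i + d) + 1 \<le> (2::real) ^ M"
      by (simp_all add: pos_le_divide_eq pos_divide_le_eq del: of_int_add)
    then have id: "0 \<le> i + d" "i + d < 2 ^ M"
    proof -
      have "of_int (i + d) < (of_int (2 ^ M) :: real)"
        using \<open>of_int (i + d) + 1 \<le> 2 ^ M\<close> by simp
      then show "i + d < 2 ^ M" by (simp only: of_int_less_iff)
    qed (use \<open>0 \<le> of_int (i + d)\<close> in simp)
    then obtain v where v: "length v = M" "word_val v = real (nat (i + d)) / 2 ^ M"
      using ex_word_val[of "nat (i + d)" M] by (auto simp: nat_less_iff)
    then have "maps_word f w v"
      unfolding maps_word_def using fw id(1) by simp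
    then show ?thesis unfolding w_def by blast
  qed
  then show ?thesis by (rule that)
qed

text \<open>At level \<open>n\<close> all breakpoints are multiples of \<open>1 / 2 ^ n\<close>, so
  none lies inside an interval of that level and \<open>f\<close> is affine on each. There are
  finitely many of them, and the largest of their bounds serves for all.\<close>

lemma uniform_word_image:
  assumes f: "f \<in> carrier thompson_F"
  obtains N where "\<And>w. length w = N \<Longrightarrow> \<exists>v. maps_word f w v"
proof -
  obtain D where D: "finite D" "D \<subseteq> dyadics"
    "\<And>a b. 0 \<le> a \<Longrightarrow> a < b \<Longrightarrow> b \<le> 1 \<Longrightarrow> {a<..<b} \<inter> D = {} \<Longrightarrow>
       \<exists>k::int. \<exists>c. \<forall>t\<in>{a..b}. f t = 2 powi k * t + c"
    using f by (auto simp: carrier_thompson_F elim: pl_dyadicE)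
  obtain n where n: "\<And>d. d \<in> D \<Longrightarrow> d * 2 ^ n \<in> \<int>"
    using is_dyadic_common[OF D(1)] D(2) dyadics_iff_is_dyadic by blast
  have "\<exists>L. \<forall>z. L \<le> length z \<longrightarrow> (\<exists>v. maps_word f (u @ z) v)" if u: "length u = n" for u
  proof -
    let ?b = "word_val u + 1 / 2 ^ length u"
    have "{word_val u<..<?b} \<inter> D = {}"
    proof (rule equals0I)
      fix d assume d: "d \<in> {word_val u<..<?b} \<inter> D"
      obtain i where i: "d * 2 ^ n = of_int i" using n d by (meson IntD2 Ints_cases)
      obtain j where j: "word_val u * 2 ^ n = of_int j"
        using word_val_times_power_Ints[of u] u by (auto elim: Ints_cases)
      have "word_val u * 2 ^ n < d * 2 ^ n" "d * 2 ^ n < word_val u * 2 ^ n + 1"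
        using d u by (auto simp: field_simps)
      then have "j < i" "of_int i < (of_int (j + 1) :: real)" unfolding i j by simp_all
      then show False by (simp only: of_int_less_iff)
    qed
    then obtain k :: int and c where kc: "\<forall>t\<in>{word_val u..?b}. f t = 2 powi k * t + c"
      using D(3)[of "word_val u" ?b] word_val_bounds by auto
    obtain L where "\<And>z. L \<le> length z \<Longrightarrow> \<exists>v. maps_word f (u @ z) v"
      using affine_word_image[OF f kc[THEN bspec]] by metis
    then show ?thesis by blast
  qed
  then obtain L where L: "\<And>u z. length u = n \<Longrightarrow> L u \<le> length z \<Longrightarrow> \<exists>v. maps_word f (u @ z) v"
    by metis
  have fin: "finite {u::bool list. length u = n}"
    using finite_lists_length_eq[of "UNIV::bool set" n] by simp
  let ?L = "Max (L ` {u. length u = n})"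
  show ?thesis
  proof (rule that[of "n + ?L"])
    fix w :: "bool list" assume w: "length w = n + ?L"
    then have len: "length (take n w) = n" by simp
    then have "L (take n w) \<le> ?L" using fin by (intro Max_ge) auto
    then show "\<exists>v. maps_word f w v"
      using L[OF len, of "drop n w"] w by simp
  qed
qed

primrec full_tree :: "nat \<Rightarrow> bintree" where
  "full_tree 0 = Leaf"
| "full_tree (Suc n) = Caret (full_tree n) (full_tree n)"

lemma length_leaves_full_tree: "w \<in> set (leaves (full_tree n)) \<Longrightarrow> length w = n"
  by (induction n arbitrary: w) auto

section \<open>Elements acting on pairs of trees\<close>

text \<open>The working form of \<open>represents\<close>; equal numbers of leaves are built into
  \<open>list_all2\<close>.\<close>

definition transports :: "(real \<Rightarrow> real) \<Rightarrow> bintree \<Rightarrow> bintree \<Rightarrow> bool" where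
  "transports f S T \<longleftrightarrow> list_all2 (maps_word f) (leaves S) (leaves T)"

lemma transports_one: "transports \<one>\<^bsub>thompson_F\<^esub> T T"
  unfolding transports_def using maps_word_id by (auto intro: list.rel_refl)

lemma transports_mult:
  assumes "transports f S T" "transports g T U"
  shows "transports (f \<otimes>\<^bsub>thompson_F\<^esub> g) S U"
  using list_all2_trans[OF maps_word_compose] assms unfolding transports_def by simp

lemma transports_inv:
  assumes "f \<in> carrier thompson_F" "transports f S T"
  shows "transports (inv\<^bsub>thompson_F\<^esub> f) T S"
proof -
  have "maps_word (inv\<^bsub>thompson_F\<^esub> f) v u" if "maps_word f u v" for u v
    using maps_word_inverse[OF that] thompson_F_inv_apply[OF assms(1)] by blast
  then show ?thesis
    using assms(2) by (auto simp: transports_def list_all2_conv_all_nth)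
qed

lemma transports_unique:
  assumes "f \<in> carrier thompson_F" "g \<in> carrier thompson_F" "transports f S T" "transports g S T"
  shows "f = g"
  using assms maps_words_unique[of f g S "leaves T"] by (simp add: carrier_thompson_F transports_def)

text \<open>Take a full tree deep enough that all its leaf intervals have dyadic images. These
  images tile the unit interval, so they are the leaves of a second tree.\<close>

lemma thompson_F_tree_diagram:
  assumes f: "f \<in> carrier thompson_F"
  obtains S T where "transports f S T"
proof -
  obtain N where "\<And>w. length w = N \<Longrightarrow> \<exists>v. maps_word f w v"
    using uniform_word_image[OF f] by metis
  then obtain h where h: "\<And>w. length w = N \<Longrightarrow> maps_word f w (h w)" by metis
  let ?us = "leaves (full_tree N)"
  have maps: "list_all2 (maps_word f) ?us (map h ?us)"
    using h length_leaves_full_tree by (auto simp: list_all2_map2 intro!: list.rel_refl_strong)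
  then have "tiles 0 (map h ?us) 1"
    using tiles_maps_word[OF tiles_leaves] thompson_F_endpoints[OF f] by metis
  then obtain T where "leaves T = map h ?us" using tiles_imp_leaves by blast
  with maps show ?thesis using that[of "full_tree N" T] by (simp add: transports_def)
qed

text \<open>For a subgroup \<open>A\<close> this is an equivalence relation on trees, and by
  uniqueness the linking element is the only element of F that takes \<open>S\<close> to
  \<open>T\<close>.\<close>

definition linked :: "(real \<Rightarrow> real) set \<Rightarrow> bintree \<Rightarrow> bintree \<Rightarrow> bool" where
  "linked A S T \<longleftrightarrow> (\<exists>f\<in>A. transports f S T)"

lemma linked_refl: "subgroup A thompson_F \<Longrightarrow> linked A T T"
  using subgroup.one_closed[of A thompson_F] transports_one unfolding linked_def by blast

lemma linked_trans:
  assumes "subgroup A thompson_F" "linked A S T" "linked A T U"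
  shows "linked A S U"
  using assms(2,3) subgroup.m_closed[OF assms(1)] transports_mult unfolding linked_def by meson

lemma linked_sym:
  assumes "subgroup A thompson_F" "linked A S T"
  shows "linked A T S"
  using assms(2) subgroup.m_inv_closed[OF assms(1)] subgroup.mem_carrier[OF assms(1)] transports_inv
  unfolding linked_def by meson

section \<open>The two generators as rotations\<close>

text \<open>The slopes 2, 1, 1/2 decrease, so the map is concave and equals the minimum of its
  affine pieces.\<close>

definition thompson_x0 :: "real \<Rightarrow> real" where
  "thompson_x0 = restrict (\<lambda>t. min (2 * t) (min (t + 1 / 4) ((1 + t) / 2))) {0..1}"

text \<open>A half-size copy of \<open>thompson_x0\<close> on the right half; the maximum with
  \<open>t\<close> makes it the identity on the left half.\<close>

definition thompson_x1 :: "real \<Rightarrow> real" where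
  "thompson_x1 = restrict (\<lambda>t. max t (min (2 * t - 1 / 2) (min (t + 1 / 8) ((1 + t) / 2)))) {0..1}"

lemma dyadic_fraction: "of_nat m / 2 ^ k \<in> dyadics"
  unfolding dyadics_def by blast

lemma thompson_x0_in_carrier: "thompson_x0 \<in> carrier thompson_F"
proof (rule thompson_FI)
  have "continuous_on {0..1} (\<lambda>t::real. min (2 * t) (min (t + 1 / 4) ((1 + t) / 2)))"
    by (intro continuous_intros) auto
  then show "continuous_on {0..1} thompson_x0"
    by (rule continuous_on_eq) (simp add: thompson_x0_def)
  show "strict_mono_on {0..1} thompson_x0"
    by (auto simp: thompson_x0_def strict_mono_on_def min_def field_simps)
  have dy: "1 / 4 \<in> (dyadics :: real set)" "1 / 2 \<in> (dyadics :: real set)"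
    using dyadic_fraction[of 1 2] dyadic_fraction[of 1 1] by simp_all
  show "pl_dyadic thompson_x0"
    unfolding pl_dyadic_def
  proof (intro exI[of _ "{1 / 4, 1 / 2}"] conjI allI impI)
    fix a b :: real
    assume ab: "0 \<le> a \<and> a < b \<and> b \<le> 1 \<and> {a<..<b} \<inter> {1 / 4, 1 / 2} = {}"
    then consider "b \<le> 1 / 4" | "1 / 4 \<le> a" "b \<le> 1 / 2" | "1 / 2 \<le> a" by force
    then show "\<exists>(k::int) c. \<forall>t\<in>{a..b}. thompson_x0 t = 2 powi k * t + c"
    proof cases
      case 1
      with ab show ?thesis by (intro exI[of _ 1] exI[of _ 0]) (auto simp: thompson_x0_def min_def)
    next
      case 2
      with ab show ?thesis by (intro exI[of _ 0] exI[of _ "1 / 4"]) (auto simp: thompson_x0_def min_def)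
    next
      case 3
      with ab show ?thesis
        by (intro exI[of _ "- 1"] exI[of _ "1 / 2"]) (auto simp: thompson_x0_def min_def field_simps)
    qed
  qed (use dy in auto)
qed (auto simp: thompson_x0_def)

lemma thompson_x1_in_carrier: "thompson_x1 \<in> carrier thompson_F"
proof (rule thompson_FI)
  have "continuous_on {0..1}
      (\<lambda>t::real. max t (min (2 * t - 1 / 2) (min (t + 1 / 8) ((1 + t) / 2))))"
    by (intro continuous_intros) auto
  then show "continuous_on {0..1} thompson_x1"
    by (rule continuous_on_eq) (simp add: thompson_x1_def)
  show "strict_mono_on {0..1} thompson_x1"
    by (auto simp: thompson_x1_def strict_mono_on_def min_def max_def field_simps)
  have dy: "1 / 2 \<in> (dyadics :: real set)" "5 / 8 \<in> (dyadics :: real set)"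
    "3 / 4 \<in> (dyadics :: real set)"
    using dyadic_fraction[of 1 1] dyadic_fraction[of 5 3] dyadic_fraction[of 3 2] by simp_all
  show "pl_dyadic thompson_x1"
    unfolding pl_dyadic_def
  proof (intro exI[of _ "{1 / 2, 5 / 8, 3 / 4}"] conjI allI impI)
    fix a b :: real
    assume ab: "0 \<le> a \<and> a < b \<and> b \<le> 1 \<and> {a<..<b} \<inter> {1 / 2, 5 / 8, 3 / 4} = {}"
    then consider "b \<le> 1 / 2" | "1 / 2 \<le> a" "b \<le> 5 / 8" | "5 / 8 \<le> a" "b \<le> 3 / 4" | "3 / 4 \<le> a"
      by force
    then show "\<exists>(k::int) c. \<forall>t\<in>{a..b}. thompson_x1 t = 2 powi k * t + c"
    proof cases
      case 1
      with ab show ?thesis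
        by (intro exI[of _ 0] exI[of _ 0]) (auto simp: thompson_x1_def min_def max_def)
    next
      case 2
      with ab show ?thesis
        by (intro exI[of _ 1] exI[of _ "- 1 / 2"]) (auto simp: thompson_x1_def min_def max_def)
    next
      case 3
      with ab show ?thesis
        by (intro exI[of _ 0] exI[of _ "1 / 8"]) (auto simp: thompson_x1_def min_def max_def)
    next
      case 4
      with ab show ?thesis
        by (intro exI[of _ "- 1"] exI[of _ "1 / 2"]) (auto simp: thompson_x1_def min_def max_def field_simps)
    qed
  qed (use dy in auto)
qed (auto simp: thompson_x1_def)

lemma maps_word_x0:
  "maps_word thompson_x0 [False, False] [False]"
  "maps_word thompson_x0 [False, True] [True, False]"
  "maps_word thompson_x0 [True] [True, True]"
  by (auto simp: maps_word_def thompson_x0_def min_def field_simps)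

lemma maps_word_x1:
  "maps_word thompson_x1 [False] [False]"
  "maps_word thompson_x1 [True, False, False] [True, False]"
  "maps_word thompson_x1 [True, False, True] [True, True, False]"
  "maps_word thompson_x1 [True, True] [True, True, True]"
  by (auto simp: maps_word_def thompson_x1_def min_def max_def field_simps)

lemma transports_x0: "transports thompson_x0 (Caret (Caret P Q) R) (Caret P (Caret Q R))"
  using maps_word_x0[THEN maps_word_append] unfolding transports_def
  by (simp add: list_all2_append list_all2_map1 list_all2_map2 list_all2_same)

lemma transports_x1:
  "transports thompson_x1 (Caret P (Caret (Caret Q R) U)) (Caret P (Caret Q (Caret R U)))"
  using maps_word_x1[THEN maps_word_append] unfolding transports_def
  by (simp add: list_all2_append list_all2_map1 list_all2_map2 list_all2_same)

section \<open>Connecting all trees of equal size by rotations\<close>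

primrec right_comb :: "nat \<Rightarrow> bintree" where
  "right_comb 0 = Leaf"
| "right_comb (Suc n) = Caret Leaf (right_comb n)"

lemma length_leaves: "length (leaves T) = Suc (size T)"
  by (induction T) auto

lemma transports_size: "transports f S T \<Longrightarrow> size S = size T"
  unfolding transports_def using list_all2_lengthD[of _ "leaves S" "leaves T"] by (simp add: length_leaves)

text \<open>\<open>A\<close> stays arbitrary because it is used twice: for the whole carrier the
  result produces an element for any two trees of equal size, and for the generated subgroup it
  shows that the two rotations generate F.\<close>

context
  fixes A
  assumes A: "subgroup A thompson_F" "thompson_x0 \<in> A" "thompson_x1 \<in> A"
begin

lemma linked_x0: "linked A (Caret (Caret P Q) R) (Caret P (Caret Q R))"
  using A(2) transports_x0 unfolding linked_def by blast

lemma linked_x1: "linked A (Caret P (Caret (Caret Q R) U)) (Caret P (Caret Q (Caret R U)))"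
  using A(3) transports_x1 unfolding linked_def by blast

text \<open>Rotations at the right child make the left subtree of \<open>D\<close> a leaf; an inverse rotation at the
  root then moves that leaf next to \<open>P\<close>, so that the remainder of \<open>D\<close> is the right child again.\<close>

lemma linked_comb_right: "linked A (Caret P D) (Caret P (right_comb (size D)))"
proof (induction "size D" arbitrary: P D rule: less_induct)
  case less
  show ?case
  proof (cases D)
    case Leaf
    then show ?thesis using linked_refl[OF A(1)] by simp
  next
    case (Caret B C)
    have "linked A (Caret P (Caret B C)) (Caret P (right_comb (Suc (size B + size C))))"
      if "size B + size C < size D" for B C
      using that
    proof (induction B arbitrary: C)
      case Leaf
      have 1: "linked A (Caret P (Caret Leaf C)) (Caret (Caret P Leaf) C)"
        using linked_sym[OF A(1) linked_x0] .
      have 2: "linked A (Caret (Caret P Leaf) C) (Caret (Caret P Leaf) (right_comb (size C)))"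
        using Leaf by (intro less) simp
      have 3: "linked A (Caret (Caret P Leaf) (right_comb (size C)))
          (Caret P (Caret Leaf (right_comb (size C))))"
        using linked_x0 .
      show ?case using linked_trans[OF A(1) linked_trans[OF A(1) 1 2] 3] by simp
    next
      case (Caret B1 B2)
      have 1: "linked A (Caret P (Caret (Caret B1 B2) C)) (Caret P (Caret B1 (Caret B2 C)))"
        using linked_x1 .
      have 2: "linked A (Caret P (Caret B1 (Caret B2 C)))
          (Caret P (right_comb (Suc (size B1 + size (Caret B2 C)))))"
        using Caret.prems by (intro Caret.IH(1)) simp
      show ?case using linked_trans[OF A(1) 1 2] by (simp add: add.assoc)
    qed
    from this[of B C] Caret show ?thesis by simp
  qed
qed

text \<open>Root rotations shift carets from the left child to the right child until the left one is
  a leaf; \<open>linked_comb_right\<close> then straightens the right one.\<close>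

lemma linked_comb: "linked A T (right_comb (size T))"
proof (cases T)
  case Leaf
  then show ?thesis using linked_refl[OF A(1)] by simp
next
  case (Caret P D)
  have "linked A (Caret P D) (right_comb (Suc (size P + size D)))"
  proof (induction P arbitrary: D)
    case Leaf
    then show ?case using linked_comb_right by simp
  next
    case (Caret P1 P2)
    have "linked A (Caret (Caret P1 P2) D) (Caret P1 (Caret P2 D))"
      using linked_x0 .
    from linked_trans[OF A(1) this Caret.IH(1)] show ?case by (simp add: add.assoc)
  qed
  with Caret show ?thesis by simp
qed

lemma linked_if_same_size:
  assumes "size S = size T"
  shows "linked A S T"
  using linked_trans[OF A(1) linked_comb[of S] linked_sym[OF A(1)], of T] linked_comb[of T] assms
  by simp

text \<open>A single diagram determines an element, so the member of \<open>A\<close> linking its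
  two trees is the given element.\<close>

lemma carrier_thompson_F_subset: "carrier thompson_F \<subseteq> A"
proof
  fix f assume f: "f \<in> carrier thompson_F"
  obtain S T where ST: "transports f S T" using thompson_F_tree_diagram[OF f] .
  then have "linked A S T" by (intro linked_if_same_size transports_size)
  then obtain g where g: "g \<in> A" "transports g S T" unfolding linked_def by blast
  then have "g \<in> carrier thompson_F" using subgroup.mem_carrier[OF A(1)] by blast
  then have "f = g" using transports_unique[OF f _ ST] g by blast
  with g show "f \<in> A" by simp
qed

end

section \<open>Colorings\<close>

lemma num_leaves_simps [simp]:
  "num_leaves Leaf = 1"
  "num_leaves (Caret l r) = num_leaves l + num_leaves r"
  by (simp_all add: num_leaves_def)

lemma num_leaves_pos [simp]: "0 < num_leaves T"
  by (simp add: num_leaves_def length_leaves)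

lemma descendant_leaves_Nil: "descendant_leaves T [] = {1..num_leaves T}"
  by (auto simp: descendant_leaves_def)

lemma descendant_leaves_False: "descendant_leaves (Caret l r) (False # v) = descendant_leaves l v"
proof (rule Set.set_eqI)
  fix k
  show "k \<in> descendant_leaves (Caret l r) (False # v) \<longleftrightarrow> k \<in> descendant_leaves l v"
  proof (cases "k \<le> num_leaves l")
    case False
    then have "leaves (Caret l r) ! (k - 1) = True # leaves r ! (k - 1 - num_leaves l)"
      if "k \<le> num_leaves (Caret l r)"
      using that by (auto simp: num_leaves_def nth_append)
    with False show ?thesis by (auto simp: descendant_leaves_def)
  qed (auto simp: descendant_leaves_def num_leaves_def nth_append)
qed

lemma descendant_leaves_True:
  "descendant_leaves (Caret l r) (True # v) = (\<lambda>k. k + num_leaves l) ` descendant_leaves r v"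
proof (intro equalityI subsetI)
  fix k assume k: "k \<in> descendant_leaves (Caret l r) (True # v)"
  then have "num_leaves l < k" "k - num_leaves l \<in> descendant_leaves r v"
    by (auto simp: descendant_leaves_def num_leaves_def nth_append split: if_splits)
  then show "k \<in> (\<lambda>k. k + num_leaves l) ` descendant_leaves r v"
    by (intro image_eqI[of _ _ "k - num_leaves l"]) auto
qed (auto simp: descendant_leaves_def num_leaves_def nth_append)

lemma shift_atLeastAtMost: "(\<lambda>k. k + m) ` {p + 1..q} = {p + m + 1..q + m}" for m p q :: nat
  by (simp add: add.commute add.left_commute)

text \<open>Guarantees that the condition on \<open>p\<close> and \<open>q\<close> in
  \<open>proper_coloring\<close> is never vacuous at a vertex.\<close>

lemma descendant_leaves_interval:
  "v \<in> vertices T \<Longrightarrow> \<exists>p q. p < q \<and> descendant_leaves T v = {p + 1..q}"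
proof (induction T arbitrary: v)
  case Leaf
  then show ?case by (intro exI[of _ 0] exI[of _ 1]) (simp add: descendant_leaves_Nil)
next
  case (Caret l r)
  from Caret.prems consider "v = []" | w where "v = False # w" "w \<in> vertices l"
    | w where "v = True # w" "w \<in> vertices r" by auto
  then show ?case
  proof cases
    case 1
    then show ?thesis
      by (intro exI[of _ 0] exI[of _ "num_leaves (Caret l r)"]) (simp add: descendant_leaves_Nil)
  next
    case 2
    with Caret.IH(1)[of w] show ?thesis by (simp add: descendant_leaves_False)
  next
    case 3
    then obtain p q where "p < q" "descendant_leaves r w = {p + 1..q}" using Caret.IH(2) by blast
    with 3 show ?thesis
      unfolding descendant_leaves_True
      by (intro exI[of _ "p + num_leaves l"] exI[of _ "q + num_leaves l"])
        (simp add: descendant_leaves_True shift_atLeastAtMost)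
  qed
qed

definition proper_at :: "bintree \<Rightarrow> bool list \<Rightarrow> (nat \<Rightarrow> 3) \<Rightarrow> bool" where
  "proper_at T v c \<longleftrightarrow> (\<forall>p q. p < q \<and> descendant_leaves T v = {p + 1..q} \<longrightarrow> c p \<noteq> c q)"

lemma proper_at_eq:
  assumes "p < q" "descendant_leaves T v = {p + 1..q}"
  shows "proper_at T v c \<longleftrightarrow> c p \<noteq> c q"
proof -
  have "p' = p \<and> q' = q" if "p' < q'" "descendant_leaves T v = {p' + 1..q'}" for p' q'
    using that assms by (auto simp: Icc_eq_Icc)
  with assms show ?thesis unfolding proper_at_def by blast
qed

text \<open>\<open>s\<close> numbers the region to the left of the subtree. The root is included
  here, since inside a larger tree it has an edge to its parent. The recursion lets the simplifier
  check concrete colorings.\<close>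

primrec edges_proper :: "bintree \<Rightarrow> nat \<Rightarrow> (nat \<Rightarrow> 3) \<Rightarrow> bool" where
  "edges_proper Leaf s c \<longleftrightarrow> c s \<noteq> c (s + 1)"
| "edges_proper (Caret l r) s c \<longleftrightarrow> c s \<noteq> c (s + (num_leaves l + num_leaves r)) \<and>
     edges_proper l s c \<and> edges_proper r (s + num_leaves l) c"

lemma proper_at_False: "proper_at (Caret l r) (False # v) c \<longleftrightarrow> proper_at l v c"
  by (simp add: proper_at_def descendant_leaves_False)

lemma proper_at_True:
  assumes "v \<in> vertices r"
  shows "proper_at (Caret l r) (True # v) c \<longleftrightarrow> proper_at r v (\<lambda>i. c (i + num_leaves l))"
proof -
  obtain p q where pq: "p < q" "descendant_leaves r v = {p + 1..q}"
    using descendant_leaves_interval[OF assms] by blast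
  then have "descendant_leaves (Caret l r) (True # v) = {p + num_leaves l + 1..q + num_leaves l}"
    by (simp add: descendant_leaves_True shift_atLeastAtMost)
  with pq show ?thesis
    using proper_at_eq[of "p + num_leaves l" "q + num_leaves l"] proper_at_eq[OF pq] by auto
qed

lemma edges_proper_iff:
  "edges_proper T s c \<longleftrightarrow> (\<forall>v\<in>vertices T. proper_at T v (\<lambda>i. c (s + i)))"
proof (induction T arbitrary: s)
  case Leaf
  show ?case using proper_at_eq[of 0 1 Leaf "[]"] by (simp add: descendant_leaves_Nil)
next
  case (Caret l r)
  have "proper_at (Caret l r) [] (\<lambda>i. c (s + i)) \<longleftrightarrow> c s \<noteq> c (s + (num_leaves l + num_leaves r))"
    using proper_at_eq[of 0 "num_leaves (Caret l r)" "Caret l r" "[]"]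
    by (simp add: descendant_leaves_Nil)
  moreover have "(\<forall>v\<in>vertices r. proper_at (Caret l r) (True # v) (\<lambda>i. c (s + i)))
      \<longleftrightarrow> edges_proper r (s + num_leaves l) c"
    unfolding Caret.IH(2) using proper_at_True by (simp add: add.assoc add.commute[of "num_leaves l"])
  ultimately show ?case
    using Caret.IH(1)[of s] by (simp add: ball_Un proper_at_False)
qed

text \<open>Dropping the root leaves the conditions of the two subtrees, which share only the middle
  region.\<close>

lemma proper_coloring_iff:
  "proper_coloring (Caret l r) c \<longleftrightarrow> edges_proper l 0 c \<and> edges_proper r (num_leaves l) c"
proof -
  have "proper_coloring (Caret l r) c \<longleftrightarrow>
      (\<forall>v\<in>Cons False ` vertices l \<union> Cons True ` vertices r. proper_at (Caret l r) v c)"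
    unfolding proper_coloring_def proper_at_def by (intro ball_cong) auto
  also have "\<dots> \<longleftrightarrow> edges_proper l 0 c \<and> edges_proper r (num_leaves l) c"
    unfolding edges_proper_iff
    by (simp add: ball_Un proper_at_False proper_at_True add.commute[of "num_leaves l"])
  finally show ?thesis .
qed

section \<open>Parity of the outermost branches\<close>

primrec left_depth :: "bintree \<Rightarrow> nat" where
  "left_depth Leaf = 0"
| "left_depth (Caret l r) = Suc (left_depth l)"

primrec right_depth :: "bintree \<Rightarrow> nat" where
  "right_depth Leaf = 0"
| "right_depth (Caret l r) = Suc (right_depth r)"

lemma leaves_not_Nil [simp]: "leaves T \<noteq> []"
  by (induction T) auto

lemma hd_leaves: "hd (leaves T) = replicate (left_depth T) False"
  by (induction T) (auto simp: hd_map)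

lemma last_leaves: "last (leaves T) = replicate (right_depth T) True"
  by (induction T) (auto simp: last_map)

text \<open>The two nonzero elements of the integers modulo 3 are negatives of each other, so two
  distinct nonzero differences are opposite.\<close>

lemma third_color:
  fixes a b d :: 3
  assumes "a \<noteq> b" "b \<noteq> d" "a \<noteq> d"
  shows "b - a = - (d - a)" "d - b = - (d - a)"
  using assms exhaust_3[of a] exhaust_3[of b] exhaust_3[of d] by auto

lemma edges_proper_ends: "edges_proper T s c \<Longrightarrow> c s \<noteq> c (s + num_leaves T)"
  by (cases T) auto

lemma left_color_step:
  "edges_proper T s c \<Longrightarrow> c (s + 1) - c s = (- 1) ^ left_depth T * (c (s + num_leaves T) - c s)"
proof (induction T)
  case (Caret l r)
  then have "c s \<noteq> c (s + num_leaves l)" "c (s + num_leaves l) \<noteq> c (s + (num_leaves l + num_leaves r))"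
    using edges_proper_ends[of l s c] edges_proper_ends[of r "s + num_leaves l" c]
    by (auto simp: add.assoc)
  then have "c (s + num_leaves l) - c s = - (c (s + num_leaves (Caret l r)) - c s)"
    using third_color(1) Caret.prems by simp
  with Caret.IH(1) Caret.prems
  have "c (s + 1) - c s = (- 1) ^ left_depth l * - (c (s + num_leaves (Caret l r)) - c s)"
    by (metis edges_proper.simps(2))
  then show ?case
    by (simp only: left_depth.simps power_Suc mult_minus1 mult_1 mult_minus_left mult_minus_right)
qed simp

lemma right_color_step:
  "edges_proper T s c \<Longrightarrow> c (s + num_leaves T) - c (s + num_leaves T - 1)
     = (- 1) ^ right_depth T * (c (s + num_leaves T) - c s)"
proof (induction T arbitrary: s)
  case (Caret l r)
  then have "c s \<noteq> c (s + num_leaves l)" "c (s + num_leaves l) \<noteq> c (s + (num_leaves l + num_leaves r))"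
    using edges_proper_ends[of l s c] edges_proper_ends[of r "s + num_leaves l" c]
    by (auto simp: add.assoc)
  then have "c (s + num_leaves (Caret l r)) - c (s + num_leaves l)
      = - (c (s + num_leaves (Caret l r)) - c s)"
    using third_color(2) Caret.prems by simp
  moreover have "c (s + num_leaves (Caret l r)) - c (s + num_leaves (Caret l r) - 1)
      = (- 1) ^ right_depth r * (c (s + num_leaves (Caret l r)) - c (s + num_leaves l))"
    using Caret.IH(2)[of "s + num_leaves l"] Caret.prems by (simp add: add.assoc)
  ultimately have "c (s + num_leaves (Caret l r)) - c (s + num_leaves (Caret l r) - 1)
      = (- 1) ^ right_depth r * - (c (s + num_leaves (Caret l r)) - c s)"
    by metis
  then show ?case
    by (simp only: right_depth.simps power_Suc mult_minus1 mult_1 mult_minus_left mult_minus_right)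
qed simp

lemma sign_eq_iff:
  fixes x :: 3
  assumes "x \<noteq> 0"
  shows "(- 1) ^ m * x = (- 1) ^ n * x \<longleftrightarrow> even (m + n)"
  using assms exhaust_3[of x] by (cases "even m"; cases "even n") auto

lemma minus_one_power_move: "y = (- 1) ^ n * x \<longleftrightarrow> x = (- 1) ^ n * y" for x y :: 3
  by (cases "even n") auto

text \<open>If the outer colors agree, the two middle colors at the roots may differ, and then the depths at
  both ends change parity together; otherwise the middle color is forced.\<close>

lemma strip_coloring_parity:
  assumes "num_leaves S = num_leaves T" "proper_coloring S c" "proper_coloring T c"
  shows "even (left_depth S + right_depth S + (left_depth T + right_depth T))"
proof (cases S)
  case Leaf
  with assms(1) have "T = Leaf" by (cases T) (auto simp: num_leaves_def length_leaves)
  with Leaf show ?thesis by simp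
next
  case S: (Caret l r)
  with assms(1) obtain l' r' where T: "T = Caret l' r'"
    by (cases T) (auto simp: num_leaves_def length_leaves)
  define n where "n = num_leaves S"
  \<comment> \<open>\<open>x\<close> and \<open>y\<close> involve only regions at the two ends of
    the strip, so they have the same values for both trees.\<close>
  define x where "x = c 1 - c 0"
  define y where "y = c n - c (n - 1)"
  have *: "c (num_leaves a) - c 0 = (- 1) ^ left_depth a * x \<and>
      c n - c (num_leaves a) = (- 1) ^ right_depth b * y \<and>
      c (num_leaves a) \<noteq> c 0 \<and> c n \<noteq> c (num_leaves a) \<and> x \<noteq> 0"
    if "proper_coloring (Caret a b) c" "n = num_leaves a + num_leaves b" for a b
  proof -
    have ab: "edges_proper a 0 c" "edges_proper b (num_leaves a) c"
      using that(1) by (auto simp: proper_coloring_iff)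
    have "x = (- 1) ^ left_depth a * (c (num_leaves a) - c 0)"
      using left_color_step[OF ab(1)] by (simp add: x_def)
    moreover have "y = (- 1) ^ right_depth b * (c n - c (num_leaves a))"
      using right_color_step[OF ab(2)] that(2) by (simp add: y_def)
    moreover have "c (num_leaves a) \<noteq> c 0" "c n \<noteq> c (num_leaves a)"
      using edges_proper_ends[OF ab(1)] edges_proper_ends[OF ab(2)] that(2) by auto
    ultimately show ?thesis by (auto simp: minus_one_power_move[of x] minus_one_power_move[of y])
  qed
  have nS: "n = num_leaves l + num_leaves r" "n = num_leaves l' + num_leaves r'"
    using S T assms(1) by (simp_all add: n_def)
  note 1 = *[OF assms(2)[unfolded S] nS(1)] and 2 = *[OF assms(3)[unfolded T] nS(2)]
  show ?thesis
  proof (cases "c n = c 0")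
    case True
    \<comment> \<open>With equal outer colors, the steps into and out of the middle region are
      opposite. Each tree thus fixes the sign of \<open>y\<close> relative to \<open>x\<close>, and
      the two signs must agree.\<close>
    then have "(- 1) ^ left_depth l * x = - ((- 1) ^ right_depth r * y)"
      "(- 1) ^ left_depth l' * x = - ((- 1) ^ right_depth r' * y)"
      using 1 2 by (metis minus_diff_eq)+
    then have "- y = (- 1) ^ (right_depth r + left_depth l) * x"
      "- y = (- 1) ^ (right_depth r' + left_depth l') * x"
      by (auto simp: power_add mult.assoc minus_one_power_iff)
    then have "(- 1) ^ (right_depth r + left_depth l) * x = (- 1) ^ (right_depth r' + left_depth l') * x"
      by simp
    then have "even (right_depth r + left_depth l + (right_depth r' + left_depth l'))"
      using 1 sign_eq_iff by blast
    then show ?thesis by (simp add: S T) blast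
  next
    case False
    then have eq: "c (num_leaves l) = c (num_leaves l')"
      using 1 2 exhaust_3[of "c 0"] exhaust_3[of "c n"] exhaust_3[of "c (num_leaves l)"]
        exhaust_3[of "c (num_leaves l')"] by metis
    have "y \<noteq> 0" using 1 by auto
    with 1 2 eq have "even (left_depth l + left_depth l')" "even (right_depth r + right_depth r')"
      using sign_eq_iff by metis+
    then show ?thesis by (auto simp: S T)
  qed
qed

section \<open>End slopes from depths\<close>

lemma maps_word_germ_0:
  assumes "maps_word f (replicate a False) (replicate b False)"
  shows "germ f 0 (int a - int b)"
  unfolding germ_def
proof (intro exI[of _ "1 / 2 ^ a"] conjI ballI impI)
  fix t :: real assume "t \<in> {0..1}" "\<bar>t - 0\<bar> < 1 / 2 ^ a"
  then have "t * 2 ^ a \<in> {0..1}" by (auto simp: field_simps)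
  then have "f (t * 2 ^ a / 2 ^ a) = t * 2 ^ a / 2 ^ b"
    using assms unfolding maps_word_def by fastforce
  then show "f t = 0 + 2 powi (int a - int b) * (t - 0)"
    by (simp add: power_int_diff)
qed simp

lemma maps_word_germ_1:
  assumes "maps_word f (replicate a True) (replicate b True)"
  shows "germ f 1 (int a - int b)"
  unfolding germ_def
proof (intro exI[of _ "1 / 2 ^ a"] conjI ballI impI)
  fix t :: real assume t: "t \<in> {0..1}" "\<bar>t - 1\<bar> < 1 / 2 ^ a"
  \<comment> \<open>The relative position of \<open>t\<close> in the last interval, from
    \<open>1 - 1 / 2 ^ a\<close> to 1.\<close>
  let ?s = "1 - (1 - t) * 2 ^ a"
  have "?s \<in> {0..1}" using t by (auto simp: field_simps)
  then have "f (1 - 1 / 2 ^ a + ?s / 2 ^ a) = 1 - 1 / 2 ^ b + ?s / 2 ^ b"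
    using assms unfolding maps_word_def by fastforce
  moreover have "1 - 1 / 2 ^ a + ?s / 2 ^ a = t" by (simp add: field_simps)
  ultimately have "f t = 1 - (1 - t) * 2 ^ a / 2 ^ b" by (simp add: diff_divide_distrib)
  then show "f t = 1 + 2 powi (int a - int b) * (t - 1)"
    by (simp add: power_int_diff left_diff_distrib diff_divide_distrib algebra_simps)
qed simp

lemma transports_end_slope_diff:
  assumes "transports f S T"
  shows "end_slope_diff f
    = of_int ((int (left_depth S) - int (left_depth T)) - (int (right_depth S) - int (right_depth T)))"
proof -
  have len: "length (leaves S) = length (leaves T)"
    using assms list_all2_lengthD by (auto simp: transports_def)
  have nth: "maps_word f (leaves S ! i) (leaves T ! i)" if "i < length (leaves S)" for i
    using assms that by (auto simp: transports_def list_all2_conv_all_nth)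
  have "maps_word f (hd (leaves S)) (hd (leaves T))"
    using nth[of 0] len by (simp add: hd_conv_nth)
  moreover have "maps_word f (last (leaves S)) (last (leaves T))"
    using nth[of "length (leaves S) - 1"] len by (simp add: last_conv_nth)
  ultimately show ?thesis
    using germ_unit_deriv[OF maps_word_germ_0] germ_unit_deriv[OF maps_word_germ_1]
    by (simp add: hd_leaves last_leaves end_slope_diff_def)
qed

lemma represents_iff_transports:
  "num_leaves S = num_leaves T \<Longrightarrow> represents (S, T) f \<longleftrightarrow> transports f S T"
  by (simp add: represents_iff transports_def)

lemma strip_colorable_in_H: "strip_colorable_elements \<subseteq> H_subgroup"
proof
  fix f assume "f \<in> strip_colorable_elements"
  then obtain S T c where f: "f \<in> carrier thompson_F" and n: "num_leaves S = num_leaves T"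
    and "represents (S, T) f" and c: "proper_coloring S c" "proper_coloring T c"
    by (auto simp: strip_colorable_elements_def tree_diagram_def strip_colorable_def)
  then have "transports f S T" by (simp add: represents_iff_transports)
  \<comment> \<open>The coloring gives the parity of the sum of the four depths; the slopes involve
    an alternating sum, which agrees modulo 2.\<close>
  moreover have "even ((int (left_depth S) - int (left_depth T)) - (int (right_depth S) - int (right_depth T)))"
    using strip_coloring_parity[OF n c] by simp blast
  ultimately show "f \<in> H_subgroup"
    using f transports_end_slope_diff unfolding H_subgroup_iff by (metis evenE of_int_mult of_int_numeral)
qed

section \<open>Products of elements with colorable strip\<close>

text \<open>Connectedness under all of F supplies the element, so no piecewise linear map has to be
  built from the two trees.\<close>

lemma strip_colorable_linked:
  assumes "size S = size T" "proper_coloring S c" "proper_coloring T c"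
  shows "linked strip_colorable_elements S T"
proof -
  interpret group thompson_F by (rule group_thompson_F)
  have "linked (carrier thompson_F) S T"
    using linked_if_same_size[OF subgroup_self] thompson_x0_in_carrier thompson_x1_in_carrier assms(1)
    by blast
  then obtain f where f: "f \<in> carrier thompson_F" "transports f S T" unfolding linked_def by blast
  have "num_leaves S = num_leaves T" using assms(1) by (simp add: num_leaves_def length_leaves)
  with f assms have "tree_diagram (S, T) \<and> represents (S, T) f \<and> strip_colorable (S, T)"
    by (auto simp: tree_diagram_def strip_colorable_def represents_iff_transports)
  with f have "f \<in> strip_colorable_elements" unfolding strip_colorable_elements_def by blast
  with f show ?thesis unfolding linked_def by blast
qed

lemma subgroup_E_tilde: "subgroup E_tilde thompson_F"
  unfolding E_tilde_def
  by (rule group.generate_is_subgroup[OF group_thompson_F]) (auto simp: strip_colorable_elements_def)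

lemma linked_E_tildeI:
  assumes "size S = size T" "proper_coloring S c" "proper_coloring T c"
  shows "linked E_tilde S T"
  using strip_colorable_linked[OF assms] generate.incl unfolding linked_def E_tilde_def by metis

text \<open>By uniqueness, any chain of links in \<open>A\<close> between the trees of one diagram
  of \<open>f\<close> puts \<open>f\<close> itself into \<open>A\<close>.\<close>

lemma transports_in_subgroup:
  assumes "subgroup A thompson_F" "linked A S T" "f \<in> carrier thompson_F" "transports f S T"
  shows "f \<in> A"
  using assms(2) subgroup.mem_carrier[OF assms(1)] transports_unique[OF assms(3) _ assms(4)]
  unfolding linked_def by blast

lemma E_tilde_subset_H: "E_tilde \<subseteq> H_subgroup"
  unfolding E_tilde_def
  by (rule group.generate_subgroup_incl[OF group_thompson_F strip_colorable_in_H subgroup_H])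

lemma thompson_x0_in_E_tilde: "thompson_x0 \<in> E_tilde"
proof (rule transports_in_subgroup[OF subgroup_E_tilde _ thompson_x0_in_carrier transports_x0])
  show "linked E_tilde (Caret (Caret Leaf Leaf) Leaf) (Caret Leaf (Caret Leaf Leaf))"
    \<comment> \<open>Up to renaming colors this is the only choice: both outer regions get the
      third color beside regions 1 and 2.\<close>
    by (rule linked_E_tildeI[where c = "(!) [0, 1, 2, 0]"])
      (simp_all add: proper_coloring_iff)
qed

text \<open>\<open>?T0\<close> and \<open>?T3\<close> have no common coloring: in \<open>?T3\<close>
  region 5 borders regions 1 to 4, forcing 1 and 3 to agree, while these are adjacent in
  \<open>?T0\<close>. The outer links of the chain are root rotations; the middle one is
  new.\<close>

lemma thompson_x1_square_in_E_tilde: "thompson_x1 \<otimes>\<^bsub>thompson_F\<^esub> thompson_x1 \<in> E_tilde"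
proof (rule transports_in_subgroup[OF subgroup_E_tilde])
  let ?T0 = "Caret Leaf (Caret (Caret (Caret Leaf Leaf) Leaf) Leaf)"
  let ?T1 = "Caret (Caret Leaf (Caret (Caret Leaf Leaf) Leaf)) Leaf"
  let ?T2 = "Caret (Caret Leaf Leaf) (Caret Leaf (Caret Leaf Leaf))"
  let ?T3 = "Caret Leaf (Caret Leaf (Caret Leaf (Caret Leaf Leaf)))"
  have 1: "linked E_tilde ?T0 ?T1"
    by (rule linked_E_tildeI[where c = "(!) [0, 1, 2, 0, 2, 0]"]) (simp_all add: proper_coloring_iff)
  have 2: "linked E_tilde ?T1 ?T2"
    by (rule linked_E_tildeI[where c = "(!) [0, 1, 2, 0, 2, 1]"]) (simp_all add: proper_coloring_iff)
  have 3: "linked E_tilde ?T2 ?T3"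
    by (rule linked_E_tildeI[where c = "(!) [0, 1, 2, 1, 2, 0]"]) (simp_all add: proper_coloring_iff)
  show "linked E_tilde ?T0 ?T3"
    using linked_trans[OF subgroup_E_tilde linked_trans[OF subgroup_E_tilde 1 2] 3] .
  show "transports (thompson_x1 \<otimes>\<^bsub>thompson_F\<^esub> thompson_x1) ?T0 ?T3"
    by (rule transports_mult[OF transports_x1 transports_x1])
  show "thompson_x1 \<otimes>\<^bsub>thompson_F\<^esub> thompson_x1 \<in> carrier thompson_F"
    using thompson_F_compose thompson_x1_in_carrier by simp
qed

text \<open>\<open>?U0\<close> and \<open>?U2\<close> have no common coloring: regions 2 and 5 both
  border regions 3 and 4, so they would agree, yet they are adjacent in \<open>?U0\<close>. The
  first link is a root rotation back to \<open>?U1\<close>.\<close>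

lemma thompson_x0_conjugate_in_E_tilde:
  "thompson_x1 \<otimes>\<^bsub>thompson_F\<^esub> thompson_x0 \<otimes>\<^bsub>thompson_F\<^esub> inv\<^bsub>thompson_F\<^esub> thompson_x1 \<in> E_tilde"
proof (rule transports_in_subgroup[OF subgroup_E_tilde])
  interpret group thompson_F by (rule group_thompson_F)
  let ?U0 = "Caret (Caret Leaf Leaf) (Caret (Caret Leaf Leaf) Leaf)"
  let ?U1 = "Caret (Caret (Caret Leaf Leaf) (Caret Leaf Leaf)) Leaf"
  let ?U2 = "Caret Leaf (Caret (Caret Leaf Leaf) (Caret Leaf Leaf))"
  have 1: "linked E_tilde ?U0 ?U1"
    by (rule linked_E_tildeI[where c = "(!) [0, 1, 2, 0, 1, 0]"]) (simp_all add: proper_coloring_iff)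
  have 2: "linked E_tilde ?U1 ?U2"
    by (rule linked_E_tildeI[where c = "(!) [0, 2, 1, 0, 2, 1]"]) (simp_all add: proper_coloring_iff)
  show "linked E_tilde ?U0 ?U2"
    using linked_trans[OF subgroup_E_tilde 1 2] .
  show "transports (thompson_x1 \<otimes>\<^bsub>thompson_F\<^esub> thompson_x0 \<otimes>\<^bsub>thompson_F\<^esub> inv\<^bsub>thompson_F\<^esub> thompson_x1) ?U0 ?U2"
    by (rule transports_mult[OF transports_mult[OF transports_x1 transports_x0]
          transports_inv[OF thompson_x1_in_carrier transports_x1]])
  show "thompson_x1 \<otimes>\<^bsub>thompson_F\<^esub> thompson_x0 \<otimes>\<^bsub>thompson_F\<^esub> inv\<^bsub>thompson_F\<^esub> thompson_x1 \<in> carrier thompson_F"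
    using thompson_x0_in_carrier thompson_x1_in_carrier by (simp del: mult_thompson_F)
qed

section \<open>Two cosets and the index of H\<close>

text \<open>The union of \<open>A\<close> and its right coset of \<open>b\<close> is stable under
  right multiplication by \<open>a\<close>, \<open>b\<close> and their inverses: passing
  \<open>a\<close> to the left of \<open>b\<close> costs the conjugate, and a second
  \<open>b\<close> is absorbed by the square.\<close>

lemma (in group) generate_two_cosets:
  assumes A: "subgroup A G" and a: "a \<in> A" and b: "b \<in> carrier G" "b \<otimes> b \<in> A"
    and conj: "b \<otimes> a \<otimes> inv b \<in> A" and g: "g \<in> generate G {a, b}"
  shows "g \<in> A \<or> g \<otimes> inv b \<in> A"
proof -
  interpret A: subgroup A G by (rule A)
  have ac: "a \<in> carrier G" using a by (rule A.mem_carrier)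
  \<comment> \<open>The left factor \<open>x\<close> is needed for products: without normality, the
    cosets of two factors do not decide the coset of their product.\<close>
  have "x \<otimes> g \<in> A \<or> x \<otimes> g \<otimes> inv b \<in> A"
    if "x \<in> carrier G" "x \<in> A \<or> x \<otimes> inv b \<in> A" for x
    using g that
  proof (induction g arbitrary: x rule: generate.induct)
    case one
    then show ?case by auto
  next
    case (incl h)
    then consider "h = a" "x \<in> A" | "h = a" "x \<otimes> inv b \<in> A" | "h = b" "x \<in> A"
      | "h = b" "x \<otimes> inv b \<in> A" by auto
    then show ?case
    proof cases
      case 1
      with a show ?thesis by auto
    next
      case 2
      then have "(x \<otimes> inv b) \<otimes> (b \<otimes> a \<otimes> inv b) \<in> A" using conj by auto
      also have "(x \<otimes> inv b) \<otimes> (b \<otimes> a \<otimes> inv b) = x \<otimes> h \<otimes> inv b"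
        using 2 incl.prems b ac by (simp add: m_assoc inv_solve_left')
      finally show ?thesis by simp
    next
      case 3
      with incl.prems b show ?thesis by (simp add: m_assoc)
    next
      case 4
      then have "(x \<otimes> inv b) \<otimes> (b \<otimes> b) \<in> A" using b by auto
      also have "(x \<otimes> inv b) \<otimes> (b \<otimes> b) = x \<otimes> h"
        using 4 incl.prems b by (simp add: m_assoc inv_solve_left')
      finally show ?thesis by simp
    qed
  next
    case (inv h)
    then consider "h = a" "x \<in> A" | "h = a" "x \<otimes> inv b \<in> A" | "h = b" "x \<in> A"
      | "h = b" "x \<otimes> inv b \<in> A" by auto
    then show ?case
    proof cases
      case 1
      with a show ?thesis by auto
    next
      case 2
      then have "(x \<otimes> inv b) \<otimes> inv (b \<otimes> a \<otimes> inv b) \<in> A" using conj by auto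
      also have "(x \<otimes> inv b) \<otimes> inv (b \<otimes> a \<otimes> inv b) = x \<otimes> inv h \<otimes> inv b"
        using 2 inv.prems b ac by (simp add: m_assoc inv_mult_group inv_solve_left')
      finally show ?thesis by simp
    next
      case 3
      then have "x \<otimes> inv (b \<otimes> b) \<in> A" using b by auto
      with 3 inv.prems b show ?thesis by (simp add: m_assoc inv_mult_group)
    next
      case 4
      then show ?thesis by simp
    qed
  next
    case (eng h1 h2)
    have h: "h1 \<in> carrier G" "h2 \<in> carrier G"
      using eng.hyps generate_in_carrier[of "{a, b}"] ac b by auto
    have "x \<otimes> h1 \<otimes> h2 \<in> A \<or> x \<otimes> h1 \<otimes> h2 \<otimes> inv b \<in> A"
      using eng.IH(1)[OF eng.prems] eng.IH(2)[of "x \<otimes> h1"] h eng.prems by auto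
    with h eng.prems show ?case by (simp add: m_assoc)
  qed
  from this[of \<one>] show ?thesis using g generate_in_carrier[of "{a, b}"] ac b by auto
qed

lemma thompson_F_generated: "carrier thompson_F = generate thompson_F {thompson_x0, thompson_x1}"
proof -
  interpret group thompson_F by (rule group_thompson_F)
  have sub: "{thompson_x0, thompson_x1} \<subseteq> carrier thompson_F"
    using thompson_x0_in_carrier thompson_x1_in_carrier by simp
  have "carrier thompson_F \<subseteq> generate thompson_F {thompson_x0, thompson_x1}"
    by (rule carrier_thompson_F_subset[OF generate_is_subgroup[OF sub]]) (auto intro: generate.incl)
  with generate_incl[OF sub] show ?thesis by blast
qed

lemma E_tilde_cosets:
  assumes "f \<in> carrier thompson_F"
  shows "f \<in> E_tilde \<or> f \<otimes>\<^bsub>thompson_F\<^esub> inv\<^bsub>thompson_F\<^esub> thompson_x1 \<in> E_tilde"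
  using assms unfolding thompson_F_generated
  by (rule group.generate_two_cosets[OF group_thompson_F subgroup_E_tilde thompson_x0_in_E_tilde
        thompson_x1_in_carrier thompson_x1_square_in_E_tilde thompson_x0_conjugate_in_E_tilde])

text \<open>The slope is 1 at 0 and 1/2 at 1, so \<open>end_slope_diff\<close> has the odd value
  1.\<close>

lemma thompson_x1_notin_H: "thompson_x1 \<notin> H_subgroup"
proof
  assume "thompson_x1 \<in> H_subgroup"
  then obtain n :: int where "end_slope_diff thompson_x1 = 2 * of_int n"
    by (auto simp: H_subgroup_iff)
  then have "of_int (2 * n) = (of_int 1 :: real)"
    using transports_end_slope_diff[OF transports_x1[of Leaf Leaf Leaf Leaf]] by simp
  then have "2 * n = 1" by (simp only: of_int_eq_iff)
  then show False by presburger
qed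

lemma E_tilde_eq_H: "E_tilde = H_subgroup"
proof
  interpret group thompson_F by (rule group_thompson_F)
  interpret H: subgroup H_subgroup thompson_F by (rule subgroup_H)
  show "H_subgroup \<subseteq> E_tilde"
  proof
    fix f assume f: "f \<in> H_subgroup"
    then have fc: "f \<in> carrier thompson_F" by (rule H.mem_carrier)
    have "f \<otimes>\<^bsub>thompson_F\<^esub> inv\<^bsub>thompson_F\<^esub> thompson_x1 \<notin> E_tilde"
    proof
      assume "f \<otimes>\<^bsub>thompson_F\<^esub> inv\<^bsub>thompson_F\<^esub> thompson_x1 \<in> E_tilde"
      then have "inv\<^bsub>thompson_F\<^esub> f \<otimes>\<^bsub>thompson_F\<^esub> (f \<otimes>\<^bsub>thompson_F\<^esub> inv\<^bsub>thompson_F\<^esub> thompson_x1) \<in> H_subgroup"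
        using E_tilde_subset_H f by blast
      then have "inv\<^bsub>thompson_F\<^esub> thompson_x1 \<in> H_subgroup"
        using fc thompson_x1_in_carrier by (simp del: mult_thompson_F one_thompson_F flip: m_assoc)
      then show False
        using H.m_inv_closed thompson_x1_notin_H thompson_x1_in_carrier by (metis inv_inv)
    qed
    then show "f \<in> E_tilde" using E_tilde_cosets[OF fc] by blast
  qed
qed (rule E_tilde_subset_H)

theorem proposition2p17:
  shows "subgroup H_subgroup thompson_F \<and>
         card (rcosets\<^bsub>thompson_F\<^esub> H_subgroup) = 2 \<and>
         E_tilde = H_subgroup"
proof -
  interpret group thompson_F by (rule group_thompson_F)
  let ?H = "H_subgroup" and ?Hx = "H_subgroup #>\<^bsub>thompson_F\<^esub> thompson_x1"
  have x1: "thompson_x1 \<in> ?Hx" by (rule rcos_self[OF thompson_x1_in_carrier subgroup_H])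
  have "?H #>\<^bsub>thompson_F\<^esub> f \<in> {?H, ?Hx}" if f: "f \<in> carrier thompson_F" for f
  proof (cases "f \<in> ?H")
    case True
    then show ?thesis using coset_join2[OF f subgroup_H] by simp
  next
    case False
    \<comment> \<open>The two cosets found for \<open>E_tilde\<close> are cosets of H, so the index
      is at most 2.\<close>
    then have "f \<otimes>\<^bsub>thompson_F\<^esub> inv\<^bsub>thompson_F\<^esub> thompson_x1 \<in> ?H"
      using E_tilde_cosets[OF f] E_tilde_eq_H by simp
    then have "f \<otimes>\<^bsub>thompson_F\<^esub> inv\<^bsub>thompson_F\<^esub> thompson_x1 \<otimes>\<^bsub>thompson_F\<^esub> thompson_x1 \<in> ?Hx"
      unfolding r_coset_def by blast
    then have "f \<in> ?Hx" using f thompson_x1_in_carrier by (simp add: m_assoc del: mult_thompson_F one_thompson_F)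
    then show ?thesis using repr_independence[OF _ thompson_x1_in_carrier subgroup_H] by simp
  qed
  moreover have "?H \<in> rcosets\<^bsub>thompson_F\<^esub> ?H"
    by (rule subgroup.subgroup_in_rcosets[OF subgroup_H group_thompson_F])
  moreover have "?Hx \<in> rcosets\<^bsub>thompson_F\<^esub> ?H"
    using rcosetsI[OF subgroup.subset[OF subgroup_H] thompson_x1_in_carrier] .
  ultimately have "rcosets\<^bsub>thompson_F\<^esub> ?H = {?H, ?Hx}" unfolding RCOSETS_def by blast
  moreover have "?H \<noteq> ?Hx" using x1 thompson_x1_notin_H by blast
  ultimately show ?thesis using subgroup_H E_tilde_eq_H by simp
qed

end
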